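(* \textsc{ConsCheck: $2$-Coloring} is fixed-parameter tractable when parameterized by the number $t^-$ of negative samples.
   Context: \textsc{ConsCheck: $2$-Coloring}: Input: a finite vertex set $V$ and labeled samples $(E_i,\lambda_i)_{i\in[t]}$, each $G_i=(V,E_i)$ a graph, $\lambda_i\in\{0,1\}$. Task: compute $X\subseteq V$ such that for each $i\in[t]$, $(X,V\setminus X)$ is a proper $2$-coloring of $G_i$ (both parts independent in $G_i$) iff $\lambda_i=1$, or report that none exists. The number of negative samples is $t^-=|\{i\in[t]:\lambda_i=0\}|$. Fixed-parameter tractable means solvable in time $f(t^-)\cdot|\mathcal{I}|^{\mathcal{O}(1)}$ for some computable $f$, where $|\mathcal{I}|$ is the input size. *)

theory Defs
  imports Main "HOL-Library.Discrete_Functions"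
begin

text \<open>
  Model of computation: the random access machine of Cook and Reckhow, over the natural numbers
  (hence truncated subtraction), with unit cost per instruction. As addition and subtraction are
  the only arithmetic operations, a number occurring within \<open>T\<close> steps has at most \<open>T\<close> bits more
  than the numbers in the input and the program; so unit cost, logarithmic cost and
  Turing machine time are polynomially related.
\<close>

datatype ram_instr =
    SETC nat nat     \<comment> \<open>\<open>SETC i a\<close>: \<open>X\<^sub>i := a\<close>\<close>
  | ADD nat nat nat  \<comment> \<open>\<open>ADD i j k\<close>: \<open>X\<^sub>i := X\<^sub>j + X\<^sub>k\<close>\<close>
  | SUB nat nat nat  \<comment> \<open>\<open>SUB i j k\<close>: \<open>X\<^sub>i := X\<^sub>j - X\<^sub>k\<close>\<close>
  | LOAD nat nat     \<comment> \<open>\<open>LOAD i j\<close>: register \<open>i\<close> receives the content of register \<open>X\<^sub>j\<close>\<close>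
  | STORE nat nat    \<comment> \<open>\<open>STORE i j\<close>: register \<open>X\<^sub>i\<close> receives \<open>X\<^sub>j\<close>\<close>
  | JPOS nat nat     \<comment> \<open>\<open>JPOS j m\<close>: continue at instruction \<open>m\<close> if \<open>X\<^sub>j > 0\<close>\<close>
  | READ nat         \<comment> \<open>next input number, or \<open>0\<close> if the input is exhausted\<close>
  | PRINT nat

record ram_config =
  pc :: nat
  reg :: "nat \<Rightarrow> nat"
  inp :: "nat list"
  out :: "nat list"

definition set_reg :: "nat \<Rightarrow> nat \<Rightarrow> ram_config \<Rightarrow> ram_config" where
  "set_reg i a s = s\<lparr>reg := (reg s)(i := a), pc := Suc (pc s)\<rparr>"

primrec exec_instr :: "ram_instr \<Rightarrow> ram_config \<Rightarrow> ram_config" where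
  "exec_instr (SETC i a) s = set_reg i a s"
| "exec_instr (ADD i j k) s = set_reg i (reg s j + reg s k) s"
| "exec_instr (SUB i j k) s = set_reg i (reg s j - reg s k) s"
| "exec_instr (LOAD i j) s = set_reg i (reg s (reg s j)) s"
| "exec_instr (STORE i j) s = set_reg (reg s i) (reg s j) s"
| "exec_instr (JPOS j m) s = s\<lparr>pc := (if reg s j > 0 then m else Suc (pc s))\<rparr>"
| "exec_instr (READ i) s =
     (case inp s of [] \<Rightarrow> set_reg i 0 s | a # as \<Rightarrow> set_reg i a (s\<lparr>inp := as\<rparr>))"
| "exec_instr (PRINT i) s = s\<lparr>out := out s @ [reg s i], pc := Suc (pc s)\<rparr>"

text \<open>A machine halts when its program counter leaves the program.\<close>

definition halted :: "ram_instr list \<Rightarrow> ram_config \<Rightarrow> bool" where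
  "halted P s \<longleftrightarrow> pc s \<ge> length P"

definition ram_step :: "ram_instr list \<Rightarrow> ram_config \<Rightarrow> ram_config" where
  "ram_step P s = (if halted P s then s else exec_instr (P ! pc s) s)"

definition initial :: "nat list \<Rightarrow> ram_config" where
  "initial w = \<lparr>pc = 0, reg = (\<lambda>_. 0), inp = w, out = []\<rparr>"

definition outputs_within :: "ram_instr list \<Rightarrow> nat list \<Rightarrow> nat \<Rightarrow> nat list \<Rightarrow> bool" where
  "outputs_within P w T y \<longleftrightarrow>
     (\<exists>n\<le>T. halted P ((ram_step P ^^ n) (initial w)) \<and> out ((ram_step P ^^ n) (initial w)) = y)"

definition computable :: "(nat \<Rightarrow> nat) \<Rightarrow> bool" where
  "computable f \<longleftrightarrow> (\<exists>P. \<forall>n. \<exists>T. outputs_within P [n] T [f n])"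

text \<open>The total number of binary digits (\<open>floor_log 0 = 0\<close>, so \<open>0\<close> counts as one digit).\<close>

definition input_size :: "nat list \<Rightarrow> nat" where
  "input_size w = (\<Sum>x\<leftarrow>w. floor_log x + 1)"

text \<open>
  A parameterized problem consists of its instances, the words encoding an instance (several, as
  sets may be listed in any order), the words that are a correct answer to an instance, and the
  parameter.
\<close>

definition fixed_parameter_tractable ::
    "('i \<Rightarrow> bool) \<Rightarrow> ('i \<Rightarrow> nat list \<Rightarrow> bool) \<Rightarrow> ('i \<Rightarrow> nat list \<Rightarrow> bool) \<Rightarrow> ('i \<Rightarrow> nat) \<Rightarrow> bool" where
  "fixed_parameter_tractable is_instance encodes answer param \<longleftrightarrow>
     (\<exists>P f c. computable f \<and>
        (\<forall>I w. is_instance I \<longrightarrow> encodes I w \<longrightarrow>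
           (\<exists>y. answer I y \<and> outputs_within P w (f (param I) * input_size w ^ c) y)))"

definition simple_graph :: "nat set \<Rightarrow> nat set set \<Rightarrow> bool" where
  "simple_graph V E \<longleftrightarrow> (\<forall>e\<in>E. e \<subseteq> V \<and> card e = 2)"

definition independent_set :: "nat set set \<Rightarrow> nat set \<Rightarrow> bool" where
  "independent_set E A \<longleftrightarrow> (\<forall>e\<in>E. \<not> e \<subseteq> A)"

definition proper_2_coloring :: "nat set set \<Rightarrow> nat set \<Rightarrow> nat set \<Rightarrow> bool" where
  "proper_2_coloring E A B \<longleftrightarrow> independent_set E A \<and> independent_set E B"

type_synonym conscheck = "nat set \<times> (nat set set \<times> bool) list"

definition conscheck_instance :: "conscheck \<Rightarrow> bool" where
  "conscheck_instance = (\<lambda>(V, S). finite V \<and> (\<forall>(E, l)\<in>set S. simple_graph V E))"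

definition num_negative :: "conscheck \<Rightarrow> nat" where
  "num_negative = (\<lambda>(V, S). card {i. i < length S \<and> \<not> snd (S ! i)})"

definition consistent :: "conscheck \<Rightarrow> nat set \<Rightarrow> bool" where
  "consistent = (\<lambda>(V, S) X. X \<subseteq> V \<and>
     (\<forall>i<length S. proper_2_coloring (fst (S ! i)) X (V - X) \<longleftrightarrow> snd (S ! i)))"

definition lists_set :: "nat list \<Rightarrow> nat set \<Rightarrow> bool" where
  "lists_set xs A \<longleftrightarrow> distinct xs \<and> set xs = A"

definition lists_edges :: "(nat \<times> nat) list \<Rightarrow> nat set set \<Rightarrow> bool" where
  "lists_edges es E \<longleftrightarrow>
     distinct (map (\<lambda>(u, v). {u, v}) es) \<and> set (map (\<lambda>(u, v). {u, v}) es) = E"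

definition encodes_sample :: "nat set set \<times> bool \<Rightarrow> nat list \<Rightarrow> bool" where
  "encodes_sample = (\<lambda>(E, l) w. \<exists>es. lists_edges es E \<and>
     w = of_bool l # length es # concat (map (\<lambda>(u, v). [u, v]) es))"

definition encodes_conscheck :: "conscheck \<Rightarrow> nat list \<Rightarrow> bool" where
  "encodes_conscheck = (\<lambda>(V, S) w. \<exists>vs ws. lists_set vs V \<and> list_all2 encodes_sample S ws \<and>
     w = length vs # vs @ length S # concat ws)"

text \<open>The answer is \<open>1\<close> followed by a list of a solution, or \<open>0\<close> if there is no solution.\<close>

definition conscheck_answer :: "conscheck \<Rightarrow> nat list \<Rightarrow> bool" where
  "conscheck_answer I y \<longleftrightarrow>
     (\<exists>X xs. consistent I X \<and> lists_set xs X \<and> y = 1 # xs) \<or>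
     ((\<nexists>X. consistent I X) \<and> y = [0])"

end

theory Submission imports Defs begin

text \<open>
  The positive samples force the coloring up to a flip \<open>\<phi>\<close> of each connected component of the union
  of their graphs (or have an odd cycle). An edge of a negative sample then becomes a constraint
  \<open>\<phi> c = \<phi> d\<close> or \<open>\<phi> c \<noteq> \<phi> d\<close> between two components, and one constraint of every negative sample has
  to hold. Let \<open>k\<close> be the number of negative samples. Scan the constraints and mark the two components
  of a constraint if they are distinct and not both marked yet, but at most \<open>2 k\<close> times per sample.
  A sample that exhausts its budget has \<open>2 k\<close> constraints, each with a component of its own; the
  constraints chosen for the other \<open>k - 1\<close> samples involve at most \<open>2 k - 2\<close> components, so one of
  these own components is free and can be flipped to satisfy the sample. Hence it suffices to try the
  flips supported on the at most \<open>4 k\<^sup>2\<close> marked components.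

  Running times are counted in a small structured language with arrays, whose compilation to random
  access machines preserves the number of steps exactly.
\<close>

section \<open>A structured language over random access machines\<close>

text \<open>The obstacle is that the number of components is not bounded in terms of
  \<open>k\<close>, so all flips cannot be tried. Marking bounds the choice: \<open>k\<close>
  samples, at most \<open>2 k\<close> marking events each and two components per event give at most
  \<open>4 k\<^sup>2\<close> marked components, and
  \<open>2 ^ (4 * k\<^sup>2) = 16 ^ (k * k)\<close> is the function of the parameter. A sample below
  its budget has only constraints inside one component or between two marked ones. The truth of such
  a constraint does not depend on flips of unmarked components. The exchange for exhausted samples
  is made one sample after the other: the new flip changes a component that no other chosen
  constraint touches, so these all stay satisfied. Each trial costs polynomial time without a factor
  depending on \<open>k\<close>, because the number of marked components is also at most twice the
  number of edges.\<close>

record store =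
  sc :: "nat \<Rightarrow> nat"
  ar :: "nat \<Rightarrow> nat \<Rightarrow> nat"
  ins :: "nat list"
  outs :: "nat list"

datatype op =
    Const nat nat
  | AddC nat nat nat
  | Add nat nat nat
  | Sub nat nat nat
  | Dist nat nat nat
  | Get nat nat nat
  | Put nat nat nat
  | Read nat
  | Print nat

datatype com =
    Op op
  | Seq com com (infixr \<open>;;\<close> 60)
  | If nat com com
  | While nat com

definition set_sc :: "nat \<Rightarrow> nat \<Rightarrow> store \<Rightarrow> store" where
  "set_sc x a s = s\<lparr>sc := (sc s)(x := a)\<rparr>"

definition set_ar :: "nat \<Rightarrow> nat \<Rightarrow> nat \<Rightarrow> store \<Rightarrow> store" where
  "set_ar j i a s = s\<lparr>ar := (ar s)(j := (ar s j)(i := a))\<rparr>"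

text \<open>The absolute difference. On bits it is exclusive or, and as a test it is positive
  exactly for unequal numbers; the programs use it in both ways.\<close>

definition gap :: "nat \<Rightarrow> nat \<Rightarrow> nat" where
  "gap a b = (a - b) + (b - a)"

lemma gap_simps [simp]:
  "gap a a = 0" "gap a b = 0 \<longleftrightarrow> a = b" "0 < gap a b \<longleftrightarrow> a \<noteq> b" "gap a 0 = a" "gap 0 a = a"
  by (auto simp: gap_def)

primrec eff :: "op \<Rightarrow> store \<Rightarrow> store" where
  "eff (Const x a) s = set_sc x a s"
| "eff (AddC x y a) s = set_sc x (sc s y + a) s"
| "eff (Add x y z) s = set_sc x (sc s y + sc s z) s"
| "eff (Sub x y z) s = set_sc x (sc s y - sc s z) s"
| "eff (Dist x y z) s = set_sc x (gap (sc s y) (sc s z)) s"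
| "eff (Get x j y) s = set_sc x (ar s j (sc s y)) s"
| "eff (Put j x y) s = set_ar j (sc s x) (sc s y) s"
| "eff (Read x) s = set_sc x (case ins s of [] \<Rightarrow> 0 | a # _ \<Rightarrow> a) (s\<lparr>ins := tl (ins s)\<rparr>)"
| "eff (Print x) s = s\<lparr>outs := outs s @ [sc s x]\<rparr>"

definition sreg :: "nat \<Rightarrow> nat" where
  "sreg x = 16 * x + 32"

text \<open>The machine cannot multiply, so four doublings produce the factor 16. The address is
  left in scratch register 0.\<close>

definition address_code :: "nat \<Rightarrow> nat \<Rightarrow> ram_instr list" where
  "address_code j y =
     [ADD 0 (sreg y) (sreg y), ADD 0 0 0, ADD 0 0 0, ADD 0 0 0, SETC 16 (j + 1), ADD 0 0 16]"

primrec op_code :: "op \<Rightarrow> ram_instr list" where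
  "op_code (Const x a) = [SETC (sreg x) a]"
| "op_code (AddC x y a) = [SETC 0 a, ADD (sreg x) (sreg y) 0]"
| "op_code (Add x y z) = [ADD (sreg x) (sreg y) (sreg z)]"
| "op_code (Sub x y z) = [SUB (sreg x) (sreg y) (sreg z)]"
| "op_code (Dist x y z) =
     [SUB 0 (sreg y) (sreg z), SUB 16 (sreg z) (sreg y), ADD (sreg x) 0 16]"
| "op_code (Get x j y) = address_code j y @ [LOAD (sreg x) 0]"
| "op_code (Put j x y) = address_code j x @ [STORE 0 (sreg y)]"
| "op_code (Read x) = [READ (sreg x)]"
| "op_code (Print x) = [PRINT (sreg x)]"

text \<open>Independent of the start address, so that \<open>code\<close> can compute forward jump
  targets before the code in between is placed.\<close>

primrec code_len :: "com \<Rightarrow> nat" where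
  "code_len (Op a) = length (op_code a)"
| "code_len (c ;; d) = code_len c + code_len d"
| "code_len (If x c d) = code_len c + code_len d + 3"
| "code_len (While x c) = code_len c + 5"

text \<open>The only jump is conditional: setting register 0 to 1 and testing it makes an
  unconditional jump. The else branch comes first because \<open>JPOS\<close> falls through on
  0.\<close>

primrec code :: "com \<Rightarrow> nat \<Rightarrow> ram_instr list" where
  "code (Op a) p = op_code a"
| "code (c ;; d) p = code c p @ code d (p + code_len c)"
| "code (If x c d) p =
     [JPOS (sreg x) (p + code_len d + 3)] @ code d (p + 1) @
     [SETC 0 1, JPOS 0 (p + code_len d + 3 + code_len c)] @ code c (p + code_len d + 3)"
| "code (While x c) p =
     [JPOS (sreg x) (p + 3)] @ [SETC 0 1, JPOS 0 (p + code_len c + 5)] @ code c (p + 3) @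
     [SETC 0 1, JPOS 0 p]"

text \<open>The added constants count the jump instructions passed: 1 for a taken test, and 2 more
  for each unconditional jump.\<close>

inductive big :: "com \<Rightarrow> store \<Rightarrow> nat \<Rightarrow> store \<Rightarrow> bool" where
  big_Op: "big (Op a) s (length (op_code a)) (eff a s)"
| big_Seq: "big c s m s' \<Longrightarrow> big d s' n s'' \<Longrightarrow> big (c ;; d) s (m + n) s''"
| big_IfT: "sc s x > 0 \<Longrightarrow> big c s n s' \<Longrightarrow> big (If x c d) s (n + 1) s'"
| big_IfF: "sc s x = 0 \<Longrightarrow> big d s n s' \<Longrightarrow> big (If x c d) s (n + 3) s'"
| big_WhileF: "sc s x = 0 \<Longrightarrow> big (While x c) s 3 s"
| big_WhileT: "sc s x > 0 \<Longrightarrow> big c s m s' \<Longrightarrow> big (While x c) s' n s'' \<Longrightarrow>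
    big (While x c) s (m + n + 3) s''"

primrec well_formed_op :: "op \<Rightarrow> bool" where
  "well_formed_op (Const x a) = True"
| "well_formed_op (AddC x y a) = True"
| "well_formed_op (Add x y z) = True"
| "well_formed_op (Sub x y z) = True"
| "well_formed_op (Dist x y z) = True"
| "well_formed_op (Get x j y) = (j < 15)"
| "well_formed_op (Put j x y) = (j < 15)"
| "well_formed_op (Read x) = True"
| "well_formed_op (Print x) = True"

primrec well_formed :: "com \<Rightarrow> bool" where
  "well_formed (Op a) = well_formed_op a"
| "well_formed (c ;; d) = (well_formed c \<and> well_formed d)"
| "well_formed (If x c d) = (well_formed c \<and> well_formed d)"
| "well_formed (While x c) = well_formed c"

text \<open>
  Registers divisible by 16 hold the scalars, except for the scratch registers 0 and 16; register
  \<open>16 i + j + 1\<close> holds entry \<open>i\<close> of array \<open>j < 15\<close>.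
\<close>

definition represents :: "ram_config \<Rightarrow> store \<Rightarrow> bool" where
  "represents r s \<longleftrightarrow> (\<forall>x. reg r (sreg x) = sc s x) \<and>
     (\<forall>j<15. \<forall>i. reg r (16 * i + j + 1) = ar s j i) \<and> inp r = ins s \<and> out r = outs s"

section \<open>Correctness of the compilation\<close>

lemma length_code [simp]: "length (code c p) = code_len c"
  by (induction c arbitrary: p) auto

definition code_at :: "ram_instr list \<Rightarrow> nat \<Rightarrow> ram_instr list \<Rightarrow> bool" where
  "code_at P p C \<longleftrightarrow> (\<exists>A B. P = A @ C @ B \<and> length A = p)"

lemma code_at_append:
  "code_at P p (C @ D) \<longleftrightarrow> code_at P p C \<and> code_at P (p + length C) D"
  unfolding code_at_def
proof safe
  fix A B assume "P = A @ (C @ D) @ B" "p = length A"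
  then show "\<exists>A' B'. A @ (C @ D) @ B = A' @ C @ B' \<and> length A' = length A"
    "\<exists>A' B'. A @ (C @ D) @ B = A' @ D @ B' \<and> length A' = length A + length C"
    by (metis append_assoc) (metis append_assoc length_append)
next
  fix A B A' B' assume "A @ C @ B = A' @ D @ B'" "length A' = length A + length C"
  then have "A' = A @ C"
    by (metis append_assoc append_eq_append_conv length_append)
  then show "\<exists>A' B'. A @ C @ B = A' @ (C @ D) @ B' \<and> length A' = length A"
    using \<open>A @ C @ B = A' @ D @ B'\<close> by (metis append_assoc)
qed

lemma code_at_Cons:
  "code_at P p (a # C) \<longleftrightarrow> code_at P p [a] \<and> code_at P (Suc p) C"
  using code_at_append[of P p "[a]" C] by simp

lemma ram_step_code_at:
  assumes "code_at P p [a]" "pc r = p"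
  shows "ram_step P r = exec_instr a r"
  using assms by (auto simp: ram_step_def halted_def code_at_def nth_append)

lemma pc_exec_instr: "(\<And>j m. a \<noteq> JPOS j m) \<Longrightarrow> pc (exec_instr a r) = Suc (pc r)"
  by (cases a) (auto simp: set_reg_def split: list.splits)

lemma ram_steps_straight_line:
  assumes "code_at P p C" "pc r = p" "\<And>j m. JPOS j m \<notin> set C"
  shows "(ram_step P ^^ length C) r = fold exec_instr C r \<and> pc (fold exec_instr C r) = p + length C"
  using assms
proof (induction C arbitrary: p r)
  case (Cons a C)
  have a: "code_at P p [a]" and C: "code_at P (Suc p) C"
    using Cons.prems(1) code_at_Cons by blast+
  have pc: "pc (exec_instr a r) = Suc p"
    using pc_exec_instr[of a r] Cons.prems by auto
  show ?case
    using Cons.IH[OF C pc] Cons.prems(3) ram_step_code_at[OF a Cons.prems(2)]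
    by (auto simp: funpow_Suc_right simp del: funpow.simps)
qed simp

lemma no_jump_op_code: "JPOS j m \<notin> set (op_code a)"
  by (cases a) (auto simp: address_code_def)

lemma array_reg_eq_iff:
  fixes i j i' j' :: nat
  assumes "j < 15" "j' < 15"
  shows "16 * i + j = 16 * i' + j' \<longleftrightarrow> i = i' \<and> j = j'"
proof
  assume eq: "16 * i + j = 16 * i' + j'"
  have "(16 * i + j) div 16 = i" "(16 * i' + j') div 16 = i'" using assms by simp_all
  then show "i = i' \<and> j = j'" using eq by simp
qed simp

text \<open>Scalar registers are divisible by 16, whereas array registers have residue
  \<open>j + 1\<close>, between 1 and 15. The last fact keeps array registers away from scratch
  register 16.\<close>

lemma array_reg_neq_sreg:
  fixes i j x :: nat
  assumes "j < 15"
  shows "Suc (16 * i + j) \<noteq> 16 * x + 32" "16 * x + 32 \<noteq> Suc (16 * i + j)" "16 * i + j \<noteq> 15"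
proof -
  have "Suc (16 * i + j) mod 16 = Suc j"
    using mod_mult_self4[of 16 i "Suc j"] assms by simp
  then have "\<not> 16 dvd Suc (16 * i + j)"
    unfolding dvd_eq_mod_eq_0 by simp
  moreover have "16 dvd 16 * x + 32" by (simp add: dvd_add)
  ultimately show "Suc (16 * i + j) \<noteq> 16 * x + 32" "16 * x + 32 \<noteq> Suc (16 * i + j)"
    "16 * i + j \<noteq> 15"
    by (metis, metis, fastforce)
qed

lemma address_code_correct:
  assumes "represents r s" "j < 15"
  shows "represents (fold exec_instr (address_code j y) r) s"
    "reg (fold exec_instr (address_code j y) r) 0 = 16 * sc s y + j + 1"
proof -
  show "represents (fold exec_instr (address_code j y) r) s"
    using assms
    by (auto simp: represents_def set_reg_def sreg_def address_code_def array_reg_neq_sreg)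
  show "reg (fold exec_instr (address_code j y) r) 0 = 16 * sc s y + j + 1"
    using assms by (auto simp: represents_def set_reg_def sreg_def address_code_def)
qed

lemma op_code_correct:
  assumes "represents r s" "well_formed_op a"
  shows "represents (fold exec_instr (op_code a) r) (eff a s)"
proof (cases a)
  case (Get x j y)
  then show ?thesis
    using address_code_correct[OF assms(1), of j y] assms(2)
    by (auto simp: represents_def set_reg_def set_sc_def sreg_def array_reg_neq_sreg)
next
  case (Put j x y)
  then show ?thesis
    using address_code_correct[OF assms(1), of j x] assms(2)
    by (auto simp: represents_def set_reg_def set_ar_def sreg_def array_reg_neq_sreg
        array_reg_eq_iff)
next
  case (Read x)
  then show ?thesis
    using assms(1)
    by (cases "ins s")
      (auto simp: represents_def set_reg_def set_sc_def sreg_def array_reg_neq_sreg)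
next
  case (Dist x y z)
  then show ?thesis
    using assms(1)
    by (auto simp: gap_def represents_def set_reg_def set_sc_def sreg_def array_reg_neq_sreg)
qed (use assms(1) in \<open>auto simp: represents_def set_reg_def set_sc_def sreg_def array_reg_neq_sreg\<close>)

lemma represents_jump:
  assumes "represents r s"
  shows "represents (exec_instr (SETC 0 a) r) s" "represents (exec_instr (JPOS j m) r) s"
  using assms by (auto simp: represents_def set_reg_def sreg_def)

lemma ram_unconditional_jump:
  assumes "code_at P p [SETC 0 1, JPOS 0 q]" "pc r = p" "represents r s"
  shows "\<exists>r'. (ram_step P ^^ 2) r = r' \<and> pc r' = q \<and> represents r' s"
proof -
  have c: "code_at P p [SETC 0 1]" "code_at P (Suc p) [JPOS 0 q]"
    using assms(1) code_at_Cons by blast+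
  let ?r = "exec_instr (SETC 0 1) r"
  have "ram_step P r = ?r" using ram_step_code_at[OF c(1) assms(2)] .
  moreover have "pc ?r = Suc p" "reg ?r 0 = 1" using assms(2) by (simp_all add: set_reg_def)
  moreover have "ram_step P ?r = exec_instr (JPOS 0 q) ?r"
    using ram_step_code_at[OF c(2)] calculation(2) by simp
  ultimately have "(ram_step P ^^ 2) r = exec_instr (JPOS 0 q) ?r" "pc (exec_instr (JPOS 0 q) ?r) = q"
    by (simp_all add: eval_nat_numeral)
  then show ?thesis
    using represents_jump assms(3) by metis
qed

lemma ram_branch:
  assumes "code_at P p [JPOS (sreg x) q]" "pc r = p" "represents r s"
  shows "\<exists>r'. ram_step P r = r' \<and> pc r' = (if sc s x > 0 then q else Suc p) \<and> represents r' s"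
  using ram_step_code_at[OF assms(1,2)] represents_jump(2)[OF assms(3)] assms(2,3)
  by (auto simp: represents_def)

lemma funpow_add_apply: "(f ^^ (m + n)) x = (f ^^ n) ((f ^^ m) x)"
  by (metis add.commute comp_apply funpow_add)

text \<open>Forward simulation by induction on the run. The start address is arbitrary since
  subcommands sit at shifted addresses; a loop returns to its own address after each pass.\<close>

lemma code_correct:
  assumes "big c s n s'" "well_formed c" "code_at P p (code c p)" "pc r = p" "represents r s"
  shows "\<exists>r'. (ram_step P ^^ n) r = r' \<and> pc r' = p + code_len c \<and> represents r' s'"
  using assms
proof (induction arbitrary: p r rule: big.induct)
  case (big_Op a s)
  then show ?case
    using ram_steps_straight_line[of P p "op_code a" r] no_jump_op_code op_code_correct[of r s a]
    by simp
next
  case (big_Seq c s m s' d n s'')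
  have c: "code_at P p (code c p)" "code_at P (p + code_len c) (code d (p + code_len c))"
    using big_Seq.prems(2) by (simp_all add: code_at_append)
  obtain r1 where r1: "(ram_step P ^^ m) r = r1" "pc r1 = p + code_len c" "represents r1 s'"
    using big_Seq.IH(1)[OF _ c(1)] big_Seq.prems by auto
  obtain r2 where r2: "(ram_step P ^^ n) r1 = r2" "pc r2 = p + code_len c + code_len d"
    "represents r2 s''"
    using big_Seq.IH(2)[OF _ c(2) r1(2,3)] big_Seq.prems by auto
  show ?case
    using r1 r2 by (simp add: funpow_add_apply)
next
  case (big_IfT s x c n s' d)
  have c: "code_at P p [JPOS (sreg x) (p + code_len d + 3)]"
    "code_at P (p + code_len d + 3) (code c (p + code_len d + 3))"
    using big_IfT.prems(2) unfolding code.simps code_at_append length_code list.size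
    by (simp_all add: eval_nat_numeral algebra_simps)
  obtain r1 where r1: "ram_step P r = r1" "pc r1 = p + code_len d + 3" "represents r1 s"
    using ram_branch[OF c(1) big_IfT.prems(3,4)] big_IfT.hyps by auto
  then show ?case
    using big_IfT.IH[OF _ c(2) r1(2,3)] big_IfT.prems(1)
    by (auto simp: funpow_Suc_right simp del: funpow.simps)
next
  case (big_IfF s x d n s' c)
  have c: "code_at P p [JPOS (sreg x) (p + code_len d + 3)]"
    "code_at P (Suc p) (code d (Suc p))"
    "code_at P (Suc p + code_len d) [SETC 0 1, JPOS 0 (p + code_len d + 3 + code_len c)]"
    using big_IfF.prems(2) unfolding code.simps code_at_append length_code list.size
    by (simp_all add: eval_nat_numeral algebra_simps)
  obtain r1 where r1: "ram_step P r = r1" "pc r1 = Suc p" "represents r1 s"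
    using ram_branch[OF c(1) big_IfF.prems(3,4)] big_IfF.hyps by auto
  obtain r2 where r2: "(ram_step P ^^ n) r1 = r2" "pc r2 = Suc p + code_len d" "represents r2 s'"
    using big_IfF.IH[OF _ c(2) r1(2,3)] big_IfF.prems(1) by auto
  obtain r3 where r3: "(ram_step P ^^ 2) r2 = r3" "pc r3 = p + code_len d + 3 + code_len c"
    "represents r3 s'"
    using ram_unconditional_jump[OF c(3) r2(2,3)] by auto
  have "(ram_step P ^^ (n + 3)) r = r3"
  proof -
    have "n + 3 = 1 + (n + 2)" by simp
    then show ?thesis
      using r1(1) r2(1) r3(1) by (simp only: funpow_add_apply) simp
  qed
  then show ?case using r3 by (auto simp: algebra_simps)
next
  case (big_WhileF s x c)
  have c: "code_at P p [JPOS (sreg x) (p + 3)]"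
    "code_at P (Suc p) [SETC 0 1, JPOS 0 (p + code_len c + 5)]"
    using big_WhileF.prems(2) unfolding code.simps code_at_append length_code list.size
    by (simp_all add: eval_nat_numeral algebra_simps)
  obtain r1 where r1: "ram_step P r = r1" "pc r1 = Suc p" "represents r1 s"
    using ram_branch[OF c(1) big_WhileF.prems(3,4)] big_WhileF.hyps by auto
  obtain r2 where r2: "(ram_step P ^^ 2) r1 = r2" "pc r2 = p + code_len c + 5" "represents r2 s"
    using ram_unconditional_jump[OF c(2) r1(2,3)] by auto
  have "(ram_step P ^^ 3) r = r2"
  proof -
    have "(3 :: nat) = 1 + 2" by simp
    then show ?thesis
      using r1(1) r2(1) by (simp only: funpow_add_apply) simp
  qed
  then show ?case using r2 by auto
next
  case (big_WhileT s x c m s' n s'')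
  have c: "code_at P p [JPOS (sreg x) (p + 3)]" "code_at P (p + 3) (code c (p + 3))"
    "code_at P (p + 3 + code_len c) [SETC 0 1, JPOS 0 p]"
    using big_WhileT.prems(2) unfolding code.simps code_at_append length_code list.size
    by (simp_all add: eval_nat_numeral algebra_simps)
  obtain r1 where r1: "ram_step P r = r1" "pc r1 = p + 3" "represents r1 s"
    using ram_branch[OF c(1) big_WhileT.prems(3,4)] big_WhileT.hyps by auto
  obtain r2 where r2: "(ram_step P ^^ m) r1 = r2" "pc r2 = p + 3 + code_len c" "represents r2 s'"
    using big_WhileT.IH(1)[OF _ c(2) r1(2,3)] big_WhileT.prems(1) by auto
  obtain r3 where r3: "(ram_step P ^^ 2) r2 = r3" "pc r3 = p" "represents r3 s'"
    using ram_unconditional_jump[OF c(3) r2(2,3)] by auto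
  obtain r4 where r4: "(ram_step P ^^ n) r3 = r4" "pc r4 = p + code_len (While x c)"
    "represents r4 s''"
    using big_WhileT.IH(2)[OF big_WhileT.prems(1,2) r3(2,3)] by auto
  have "m + n + 3 = 1 + (m + (2 + n))" by simp
  then have "(ram_step P ^^ (m + n + 3)) r = r4"
    using r1(1) r2(1) r3(1) r4(1) by (simp only: funpow_add_apply) simp
  then show ?case using r4 by auto
qed

section \<open>Total correctness with time bounds\<close>

definition initial_store :: "nat list \<Rightarrow> store" where
  "initial_store w = \<lparr>sc = (\<lambda>_. 0), ar = (\<lambda>_ _. 0), ins = w, outs = []\<rparr>"

text \<open>A weakest precondition with a step budget. Asking for some run is sound because
  \<open>code_correct\<close> transfers it to the deterministic machine.\<close>

definition wpt :: "com \<Rightarrow> nat \<Rightarrow> (store \<Rightarrow> bool) \<Rightarrow> store \<Rightarrow> bool" where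
  "wpt c T Q s \<longleftrightarrow> (\<exists>n s'. big c s n s' \<and> n \<le> T \<and> Q s')"

lemma outputs_within_code:
  assumes "wpt c T (\<lambda>s. outs s = y) (initial_store w)" "well_formed c"
  shows "outputs_within (code c 0) w T y"
proof -
  obtain n s' where n: "big c (initial_store w) n s'" "n \<le> T" "outs s' = y"
    using assms(1) by (auto simp: wpt_def)
  have "code_at (code c 0) 0 (code c 0)" by (simp add: code_at_def)
  moreover have "represents (initial w) (initial_store w)" "pc (initial w) = 0"
    by (simp_all add: represents_def initial_def initial_store_def)
  ultimately have "pc ((ram_step (code c 0) ^^ n) (initial w)) = code_len c"
    "represents ((ram_step (code c 0) ^^ n) (initial w)) s'"
    using code_correct[OF n(1) assms(2), of "code c 0" 0 "initial w"] by auto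
  then show ?thesis
    using n by (auto simp: outputs_within_def halted_def represents_def)
qed

lemma wpt_mono: "wpt c T Q s \<Longrightarrow> T \<le> T' \<Longrightarrow> (\<And>s. Q s \<Longrightarrow> Q' s) \<Longrightarrow> wpt c T' Q' s"
  unfolding wpt_def by (blast intro: le_trans)

inductive_cases big_OpE: "big (Op a) s n s'"
inductive_cases big_SeqE: "big (c ;; d) s n s'"
inductive_cases big_IfE: "big (If x c d) s n s'"

lemma wpt_Op: "wpt (Op a) T Q s \<longleftrightarrow> length (op_code a) \<le> T \<and> Q (eff a s)"
  by (auto simp: wpt_def elim: big_OpE intro: big_Op)

lemma wpt_Seq: "wpt c T1 (wpt d T2 Q) s \<Longrightarrow> T1 + T2 \<le> T \<Longrightarrow> wpt (c ;; d) T Q s"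
proof -
  assume *: "wpt c T1 (wpt d T2 Q) s" "T1 + T2 \<le> T"
  then obtain m s1 n s2 where "big c s m s1" "m \<le> T1" "big d s1 n s2" "n \<le> T2" "Q s2"
    by (auto simp: wpt_def)
  then have "big (c ;; d) s (m + n) s2" "m + n \<le> T" "Q s2"
    using *(2) by (auto intro: big_Seq)
  then show ?thesis
    unfolding wpt_def by blast
qed

text \<open>Being an equivalence, it serves as a rewrite rule: simplification executes straight-line
  code and subtracts its cost from the budget.\<close>

lemma wpt_Op_Seq:
  "wpt (Op a ;; d) T Q s \<longleftrightarrow> length (op_code a) \<le> T \<and> wpt d (T - length (op_code a)) Q (eff a s)"
proof
  assume "wpt (Op a ;; d) T Q s"
  then obtain n s' where "big (Op a ;; d) s n s'" "n \<le> T" "Q s'" by (auto simp: wpt_def)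
  then show "length (op_code a) \<le> T \<and> wpt d (T - length (op_code a)) Q (eff a s)"
    by (fastforce simp: wpt_def elim!: big_SeqE big_OpE)
next
  assume "length (op_code a) \<le> T \<and> wpt d (T - length (op_code a)) Q (eff a s)"
  then show "wpt (Op a ;; d) T Q s"
    by (intro wpt_Seq[of _ "length (op_code a)" _ "T - length (op_code a)"]) (auto simp: wpt_Op)
qed

lemma wpt_If:
  assumes "sc s x > 0 \<Longrightarrow> 1 \<le> T \<and> wpt c (T - 1) Q s"
    "sc s x = 0 \<Longrightarrow> 3 \<le> T \<and> wpt d (T - 3) Q s"
  shows "wpt (If x c d) T Q s"
proof (cases "sc s x > 0")
  case True
  then obtain n s' where "big c s n s'" "n \<le> T - 1" "Q s'" "1 \<le> T"
    using assms(1) by (auto simp: wpt_def)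
  then show ?thesis
    using big_IfT[OF True] unfolding wpt_def by (metis le_diff_conv2)
next
  case False
  then obtain n s' where "big d s n s'" "n \<le> T - 3" "Q s'" "3 \<le> T"
    using assms(2) by (auto simp: wpt_def)
  then show ?thesis
    using big_IfF[of s x] False unfolding wpt_def by (metis le_diff_conv2 not_gr_zero)
qed

lemma wpt_If_Seq:
  assumes "sc s x > 0 \<Longrightarrow> 1 \<le> T \<and> wpt (c ;; e) (T - 1) Q s"
    "sc s x = 0 \<Longrightarrow> 3 \<le> T \<and> wpt (d ;; e) (T - 3) Q s"
  shows "wpt (If x c d ;; e) T Q s"
proof (cases "sc s x > 0")
  case True
  then obtain n s' where n: "big (c ;; e) s n s'" "n \<le> T - 1" "Q s'" "1 \<le> T"
    using assms(1) by (auto simp: wpt_def)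
  then obtain m1 m2 s1 where "big c s m1 s1" "big e s1 m2 s'" "n = m1 + m2"
    by (auto elim: big_SeqE)
  then have "big (If x c d ;; e) s ((m1 + 1) + m2) s'" "m1 + 1 + m2 \<le> T"
    using n True by (auto intro!: big_Seq big_IfT simp del: One_nat_def)
  then show ?thesis
    using n unfolding wpt_def by blast
next
  case False
  then obtain n s' where n: "big (d ;; e) s n s'" "n \<le> T - 3" "Q s'" "3 \<le> T"
    using assms(2) by (auto simp: wpt_def)
  then obtain m1 m2 s1 where "big d s m1 s1" "big e s1 m2 s'" "n = m1 + m2"
    by (auto elim: big_SeqE)
  then have "big (If x c d ;; e) s ((m1 + 3) + m2) s'" "m1 + 3 + m2 \<le> T"
    using n False by (auto intro!: big_Seq big_IfF)
  then show ?thesis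
    using n unfolding wpt_def by blast
qed

lemma wpt_Seq_assoc: "wpt (c ;; d ;; e) T Q s \<Longrightarrow> wpt ((c ;; d) ;; e) T Q s"
proof -
  assume "wpt (c ;; d ;; e) T Q s"
  then obtain n s' where n: "big (c ;; d ;; e) s n s'" "n \<le> T" "Q s'"
    by (auto simp: wpt_def)
  then obtain m1 m2 m3 s1 s2
    where m: "big c s m1 s1" "big d s1 m2 s2" "big e s2 m3 s'" "n = m1 + (m2 + m3)"
    by (auto elim!: big_SeqE)
  have "big ((c ;; d) ;; e) s (m1 + m2 + m3) s'"
    using m(1-3) by (meson big_Seq)
  then show ?thesis
    using n m(4) unfolding wpt_def by (metis add.assoc)
qed

text \<open>The invariant is indexed by the number of passes made. Termination comes from the
  obligation \<open>i < N\<close> whenever the guard holds, so \<open>N - i\<close>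
  decreases.\<close>

lemma wpt_While:
  assumes step: "\<And>i s. I i s \<Longrightarrow> sc s x > 0 \<Longrightarrow> i < N \<and> wpt c C (I (Suc i)) s"
    and "I 0 s"
  shows "wpt (While x c) (N * (C + 3) + 3) (\<lambda>s. sc s x = 0 \<and> (\<exists>i. I i s)) s"
proof -
  have "wpt (While x c) ((N - i) * (C + 3) + 3) (\<lambda>s. sc s x = 0 \<and> (\<exists>i. I i s)) s" if "I i s" for i s
    using that
  proof (induction "N - i" arbitrary: i s rule: less_induct)
    case less
    show ?case
    proof (cases "sc s x > 0")
      case True
      then obtain m s1 where m: "i < N" "big c s m s1" "m \<le> C" "I (Suc i) s1"
        using step[OF less.prems] by (auto simp: wpt_def)
      obtain n s2 where n: "big (While x c) s1 n s2" "n \<le> (N - Suc i) * (C + 3) + 3"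
        "sc s2 x = 0" "\<exists>i. I i s2"
        using less.hyps[OF diff_less_mono2[OF lessI m(1)] m(4)] unfolding wpt_def by blast
      have "N - i = Suc (N - Suc i)" using m(1) by simp
      then have "m + n + 3 \<le> (N - i) * (C + 3) + 3" using m(3) n(2) by simp
      then show ?thesis
        using big_WhileT[OF True m(2) n(1)] n(3,4) unfolding wpt_def by blast
    next
      case False
      then have "big (While x c) s 3 s" by (simp add: big_WhileF)
      then show ?thesis
        using False less.prems unfolding wpt_def by (metis le_add2 not_gr_zero)
    qed
  qed
  from this[OF assms(2)] show ?thesis by simp
qed

definition For :: "nat \<Rightarrow> nat \<Rightarrow> nat \<Rightarrow> com \<Rightarrow> com" where
  "For i d n c =
     Op (Const i 0) ;; Op (Sub d n i) ;;
     While d (c ;; Op (AddC i i 1) ;; Op (Sub d n i))"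

lemma well_formed_For [simp]: "well_formed (For i d n c) = well_formed c"
  by (simp add: For_def)

text \<open>The loop overhead writes only the counter and the guard \<open>d\<close>, hence the
  frame condition. Per pass it costs 2 for \<open>AddC\<close>, 1 for \<open>Sub\<close> and 3 for
  the jumps; the final 5 are two initial assignments and the exit.\<close>

lemma wpt_For:
  assumes body: "\<And>j s. j < N \<Longrightarrow> I j s \<Longrightarrow> sc s i = j \<Longrightarrow> sc s n = N \<Longrightarrow>
      wpt c C (\<lambda>s'. I (Suc j) s' \<and> sc s' i = j \<and> sc s' n = N) s"
    and frame: "\<And>j s a b. I j s \<Longrightarrow> I j (set_sc d b (set_sc i a s))"
    and "I 0 s" "sc s n = N" "i \<noteq> d" "n \<noteq> i" "n \<noteq> d"
    and T: "N * (C + 6) + 5 \<le> T"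
  shows "wpt (For i d n c) T (\<lambda>s'. I N s' \<and> sc s' n = N) s"
proof -
  let ?J = "\<lambda>j s. I j s \<and> sc s i = j \<and> sc s n = N \<and> sc s d = N - j \<and> j \<le> N"
  let ?b = "c ;; Op (AddC i i 1) ;; Op (Sub d n i)"
  have "wpt (While d ?b) (N * ((C + 3) + 3) + 3) (\<lambda>s. sc s d = 0 \<and> (\<exists>j. ?J j s))
     (set_sc d N (set_sc i 0 s))"
  proof (rule wpt_While)
    fix j s assume J: "?J j s" "sc s d > 0"
    have "wpt ?b (C + 3) (?J (Suc j)) s"
    proof (rule wpt_Seq[OF _ order_refl], rule wpt_mono[OF body[of j s] order_refl])
      fix s' assume "I (Suc j) s' \<and> sc s' i = j \<and> sc s' n = N"
      then show "wpt (Op (AddC i i 1) ;; Op (Sub d n i)) 3 (?J (Suc j)) s'"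
        using frame[of "Suc j" s'] J assms(5-7)
        by (simp add: wpt_Op wpt_Op_Seq) (auto simp: set_sc_def)
    qed (use J in auto)
    then show "j < N \<and> wpt ?b (C + 3) (?J (Suc j)) s" using J by auto
  next
    show "?J 0 (set_sc d N (set_sc i 0 s))"
      using assms(3-7) frame[OF assms(3)] by (simp add: set_sc_def)
  qed
  then have "wpt (While d ?b) (N * (C + 6) + 3) (\<lambda>s'. I N s' \<and> sc s' n = N)
     (set_sc d N (set_sc i 0 s))"
    by (rule wpt_mono) auto
  then show ?thesis
    unfolding For_def using T assms(4-7)
    by (auto simp: wpt_Op_Seq set_sc_def elim: wpt_mono)
qed

lemma wpt_If_iff:
  "wpt (If x c d) T Q s \<longleftrightarrow>
     (if sc s x > 0 then 1 \<le> T \<and> wpt c (T - 1) Q s else 3 \<le> T \<and> wpt d (T - 3) Q s)"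
proof
  assume "wpt (If x c d) T Q s"
  then obtain n s' where n: "big (If x c d) s n s'" "n \<le> T" "Q s'" by (auto simp: wpt_def)
  from n(1) show "if sc s x > 0 then 1 \<le> T \<and> wpt c (T - 1) Q s else 3 \<le> T \<and> wpt d (T - 3) Q s"
  proof (rule big_IfE)
    fix m assume "n = Suc m" "0 < sc s x" "big c s m s'"
    then show ?thesis using n(2,3) unfolding wpt_def by (auto intro!: exI[of _ m])
  next
    fix m assume "n = m + 3" "sc s x = 0" "big d s m s'"
    then show ?thesis using n(2,3) unfolding wpt_def by (auto intro!: exI[of _ m])
  qed
qed (auto intro!: wpt_If split: if_splits)

lemma wpt_If_Seq_iff:
  "wpt (If x c d ;; e) T Q s \<longleftrightarrow>
     (if sc s x > 0 then 1 \<le> T \<and> wpt (c ;; e) (T - 1) Q s else 3 \<le> T \<and> wpt (d ;; e) (T - 3) Q s)"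
proof
  assume "wpt (If x c d ;; e) T Q s"
  then obtain n1 n2 s1 s2 where n: "big (If x c d) s n1 s1" "big e s1 n2 s2" "n1 + n2 \<le> T" "Q s2"
    by (auto simp: wpt_def elim!: big_SeqE)
  from n(1) show "if sc s x > 0 then 1 \<le> T \<and> wpt (c ;; e) (T - 1) Q s
     else 3 \<le> T \<and> wpt (d ;; e) (T - 3) Q s"
  proof (rule big_IfE)
    fix m assume m: "n1 = Suc m" "0 < sc s x" "big c s m s1"
    then have "big (c ;; e) s (m + n2) s2" using n(2) by (simp add: big_Seq)
    then show ?thesis using m n(3,4) unfolding wpt_def by (auto intro!: exI[of _ "m + n2"])
  next
    fix m assume m: "n1 = m + 3" "sc s x = 0" "big d s m s1"
    then have "big (d ;; e) s (m + n2) s2" using n(2) by (simp add: big_Seq)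
    then show ?thesis using m n(3,4) unfolding wpt_def by (auto intro!: exI[of _ "m + n2"])
  qed
qed (auto intro!: wpt_If_Seq split: if_splits)

lemma wpt_Seq_assoc_iff: "wpt ((c ;; d) ;; e) T Q s \<longleftrightarrow> wpt (c ;; d ;; e) T Q s"
proof
  assume "wpt ((c ;; d) ;; e) T Q s"
  then obtain m1 m2 m3 s1 s2 s3
    where m: "big c s m1 s1" "big d s1 m2 s2" "big e s2 m3 s3" "m1 + m2 + m3 \<le> T" "Q s3"
    by (auto simp: wpt_def elim!: big_SeqE)
  have "big (c ;; d ;; e) s (m1 + (m2 + m3)) s3"
    using m(1-3) by (meson big_Seq)
  then show "wpt (c ;; d ;; e) T Q s"
    using m(4,5) unfolding wpt_def by (metis add.assoc)
qed (rule wpt_Seq_assoc)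

lemma set_sc_simps [simp]:
  "sc (set_sc x a s) = (sc s)(x := a)" "ar (set_sc x a s) = ar s"
  "ins (set_sc x a s) = ins s" "outs (set_sc x a s) = outs s"
  by (simp_all add: set_sc_def)

lemma set_ar_simps [simp]:
  "sc (set_ar j i a s) = sc s" "ar (set_ar j i a s) = (ar s)(j := (ar s j)(i := a))"
  "ins (set_ar j i a s) = ins s" "outs (set_ar j i a s) = outs s"
  by (simp_all add: set_ar_def)

lemmas exec_simps = wpt_Op wpt_Op_Seq wpt_If_iff wpt_If_Seq_iff wpt_Seq_assoc_iff address_code_def

text \<open>The language has no empty command; a write to scratch scalar 30 stands in for it, which
  is why 30 is exempted in frame conditions.\<close>

abbreviation (input) Skip :: com where "Skip \<equiv> Op (Const 30 0)"

section \<open>Computability of the function of the parameter\<close>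

definition power_code :: com where
  "power_code = Op (Read 2) ;; Op (Const 3 1) ;;
     For 4 5 2 (For 6 7 2
       (Op (Add 3 3 3) ;; Op (Add 3 3 3) ;; Op (Add 3 3 3) ;; Op (Add 3 3 3))) ;;
     Op (Print 3)"

lemma computable_power: "computable (\<lambda>k. 16 ^ (k * k))"
proof -
  have "outputs_within (code power_code 0) [k] (k * (k * 10 + 11) + 8) [16 ^ (k * k)]" for k
  proof (rule outputs_within_code)
    have inner: "wpt (For 6 7 2
        (Op (Add 3 3 3) ;; Op (Add 3 3 3) ;; Op (Add 3 3 3) ;; Op (Add 3 3 3))) (k * 10 + 5)
        (\<lambda>s'. sc s' 3 = sc s 3 * 16 ^ k \<and> outs s' = [] \<and> sc s' 4 = sc s 4 \<and> sc s' 2 = k) s"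
      if "sc s 2 = k" "outs s = []" for s
    proof (rule wpt_mono[OF wpt_For[where C = 4 and N = k and
            I = "\<lambda>j s'. sc s' 3 = sc s 3 * 16 ^ j \<and> outs s' = [] \<and> sc s' 4 = sc s 4"]])
    qed (use that in \<open>auto simp: exec_simps\<close>)
    have "wpt (For 4 5 2 (For 6 7 2
        (Op (Add 3 3 3) ;; Op (Add 3 3 3) ;; Op (Add 3 3 3) ;; Op (Add 3 3 3)))) (k * (k * 10 + 11) + 5)
        (\<lambda>s'. sc s' 3 = 16 ^ (k * k) \<and> outs s' = []) s"
      if "sc s 2 = k" "outs s = []" "sc s 3 = 1" for s
    proof (rule wpt_mono[OF wpt_For[where C = "k * 10 + 5" and N = k and
            I = "\<lambda>j s'. sc s' 3 = 16 ^ (j * k) \<and> outs s' = []"]])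
      fix j and s :: store assume "j < k" "sc s 3 = 16 ^ (j * k) \<and> outs s = []" "sc s 4 = j" "sc s 2 = k"
      then show "wpt (For 6 7 2
        (Op (Add 3 3 3) ;; Op (Add 3 3 3) ;; Op (Add 3 3 3) ;; Op (Add 3 3 3))) (k * 10 + 5)
        (\<lambda>s'. (sc s' 3 = 16 ^ (Suc j * k) \<and> outs s' = []) \<and> sc s' 4 = j \<and> sc s' 2 = k) s"
        by (intro wpt_mono[OF inner]) (auto simp: power_add)
    qed (use that in auto)
    note loop = this
    have "wpt (For 4 5 2 (For 6 7 2
        (Op (Add 3 3 3) ;; Op (Add 3 3 3) ;; Op (Add 3 3 3) ;; Op (Add 3 3 3))) ;; Op (Print 3))
        (k * (k * 10 + 11) + 6) (\<lambda>s. outs s = [16 ^ (k * k)])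
        (eff (Const 3 1) (eff (Read 2) (initial_store [k])))"
      by (rule wpt_Seq[where ?T2.0 = 1, OF wpt_mono[OF loop order_refl]])
        (auto simp: exec_simps initial_store_def)
    then show "wpt power_code (k * (k * 10 + 11) + 8) (\<lambda>s. outs s = [16 ^ (k * k)]) (initial_store [k])"
      unfolding power_code_def wpt_Op_Seq by (simp add: add.commute)
  qed (simp add: power_code_def)
  then show ?thesis unfolding computable_def by blast
qed

section \<open>Flips of components\<close>

text \<open>A constraint is a triple of two components and a bit that tells whether their flips must
  be equal or different.\<close>

definition agrees :: "('a \<Rightarrow> bool) \<Rightarrow> 'a \<times> 'a \<times> bool \<Rightarrow> bool" where
  "agrees \<phi> = (\<lambda>(c, d, b). (\<phi> c \<longleftrightarrow> \<phi> d) \<longleftrightarrow> b)"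

text \<open>These are the constraints whose truth survives when all flips outside \<open>M\<close>
  are dropped.\<close>

definition supported :: "'a set \<Rightarrow> 'a \<times> 'a \<times> bool \<Rightarrow> bool" where
  "supported M = (\<lambda>(c, d, b). c = d \<or> (c \<in> M \<and> d \<in> M))"

definition many_choices :: "nat \<Rightarrow> 'a set \<Rightarrow> ('a \<times> 'a \<times> bool) set \<Rightarrow> bool" where
  "many_choices m M A \<longleftrightarrow> (\<exists>W. finite W \<and> card W = m \<and>
     (\<forall>c\<in>W. \<exists>d b. ((c, d, b) \<in> A \<or> (d, c, b) \<in> A) \<and> c \<noteq> d \<and> c \<in> M \<and> d \<in> M))"

definition endpoints :: "'a \<times> 'a \<times> bool \<Rightarrow> 'a set" where
  "endpoints = (\<lambda>(c, d, b). {c, d})"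

lemma card_endpoints: "card (endpoints x) \<le> 2" "finite (endpoints x)"
  by (cases x; auto simp: endpoints_def card_insert_if)+

lemma agrees_cong:
  "(\<And>c. c \<in> endpoints x \<Longrightarrow> \<phi> c = \<psi> c) \<Longrightarrow> agrees \<phi> x = agrees \<psi> x"
  by (cases x) (auto simp: endpoints_def agrees_def)

text \<open>The induction enlarges the set of samples whose chosen constraint is supported, while a
  single assignment satisfies the chosen constraints of all samples. A sample without
  \<open>2 * card N\<close> choices needs no change.\<close>

lemma supported_solution_exists:
  fixes A :: "'i \<Rightarrow> ('a \<times> 'a \<times> bool) set"
  assumes "finite N"
    and choices: "\<And>i. i \<in> N \<Longrightarrow> (\<forall>x\<in>A i. supported M x) \<or> many_choices (2 * card N) M (A i)"
    and sol: "\<And>i. i \<in> N \<Longrightarrow> \<exists>x\<in>A i. agrees \<phi> x"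
  shows "\<exists>\<psi>. {c. \<psi> c} \<subseteq> M \<and> (\<forall>i\<in>N. \<exists>x\<in>A i. agrees \<psi> x)"
proof -
  have "\<exists>\<psi> e. (\<forall>i\<in>N. e i \<in> A i \<and> agrees \<psi> (e i)) \<and> (\<forall>i\<in>K. supported M (e i))"
    if "finite K" "K \<subseteq> N" for K
    using that
  proof (induction K rule: finite_induct)
    case empty
    show ?case using sol by (metis empty_iff)
  next
    case (insert i K)
    then obtain \<psi> e where e: "\<forall>j\<in>N. e j \<in> A j \<and> agrees \<psi> (e j)" "\<forall>j\<in>K. supported M (e j)"
      by auto
    have i: "i \<in> N" using insert.prems by simp
    show ?case
    proof (cases "\<forall>x\<in>A i. supported M x")
      case True
      then show ?thesis using e i by blast
    next
      case False
      then obtain W where W: "finite W" "card W = 2 * card N"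
        "\<And>c. c \<in> W \<Longrightarrow> \<exists>d b. ((c, d, b) \<in> A i \<or> (d, c, b) \<in> A i) \<and> c \<noteq> d \<and> c \<in> M \<and> d \<in> M"
        using choices[OF i] unfolding many_choices_def by blast
      let ?U = "\<Union>j\<in>N - {i}. endpoints (e j)"
      have "card ?U \<le> (\<Sum>j\<in>N - {i}. card (endpoints (e j)))"
        using assms(1) by (intro card_UN_le) simp
      also have "\<dots> \<le> (\<Sum>j\<in>N - {i}. 2)"
        by (intro sum_mono card_endpoints)
      \<comment> \<open>Strict because \<open>i\<close> is left out of the sum:
        \<open>2 * (card N - 1) < 2 * card N\<close>, where \<open>i \<in> N\<close> makes
        \<open>card N\<close> positive.\<close>
      also have "\<dots> < card W"
        using W(2) i assms(1) card_gt_0_iff[of N] by (auto simp: card_Diff_singleton_if)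
      finally have "card ?U < card W" .
      moreover have "finite ?U" using assms(1) card_endpoints(2) by blast
      ultimately obtain c where c: "c \<in> W" "c \<notin> ?U"
        by (metis card_mono leD subsetI)
      from W(3)[OF c(1)] obtain d b x where x: "x \<in> A i" "x = (c, d, b) \<or> x = (d, c, b)"
        "c \<noteq> d" "c \<in> M" "d \<in> M"
        by blast
      \<comment> \<open>The other chosen constraints do not involve \<open>c\<close>, so its value is free.\<close>
      define \<psi>' where "\<psi>' = \<psi>(c := (\<psi> d \<longleftrightarrow> b))"
      have "agrees \<psi>' x" using x(2,3) by (auto simp: agrees_def \<psi>'_def)
      moreover have "agrees \<psi>' (e j)" if "j \<in> N" "j \<noteq> i" for j
      proof -
        have "c \<notin> endpoints (e j)" using c(2) that by blast
        then have "agrees \<psi>' (e j) = agrees \<psi> (e j)"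
          by (intro agrees_cong) (auto simp: \<psi>'_def)
        then show ?thesis using e(1) that by blast
      qed
      moreover have "supported M x" using x by (auto simp: supported_def)
      ultimately have "(\<forall>j\<in>N. (e(i := x)) j \<in> A j \<and> agrees \<psi>' ((e(i := x)) j)) \<and>
        (\<forall>j\<in>insert i K. supported M ((e(i := x)) j))"
        using e x(1) by auto
      then show ?thesis by blast
    qed
  qed
  from this[OF assms(1) subset_refl] obtain \<psi> e
    where e: "\<And>i. i \<in> N \<Longrightarrow> e i \<in> A i \<and> agrees \<psi> (e i) \<and> supported M (e i)"
    by blast
  \<comment> \<open>If the two components coincide, agreement ignores the flips; otherwise both lie
    in \<open>M\<close>, where the restriction changes nothing.\<close>
  have "agrees (\<lambda>c. \<psi> c \<and> c \<in> M) x" if "agrees \<psi> x" "supported M x" for x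
    using that by (auto simp: agrees_def supported_def)
  then show ?thesis
    using e by (intro exI[of _ "\<lambda>c. \<psi> c \<and> c \<in> M"]) blast
qed

definition binary_value :: "nat \<Rightarrow> (nat \<Rightarrow> nat) \<Rightarrow> nat" where
  "binary_value m b = (\<Sum>i<m. b i * 2 ^ i)"

lemma binary_value_Suc: "binary_value (Suc m) b = binary_value m b + b m * 2 ^ m"
  by (simp add: binary_value_def)

lemma binary_value_less: "(\<And>i. i < m \<Longrightarrow> b i \<le> 1) \<Longrightarrow> binary_value m b < 2 ^ m"
proof (induction m)
  case (Suc m)
  then have "binary_value m b < 2 ^ m" "b m \<le> 1" by auto
  then show ?case by (cases "b m") (auto simp: binary_value_Suc)
qed (simp add: binary_value_def)

text \<open>The lower digits sum to less than \<open>2 ^ m\<close>, so the top digit can be read off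
  and removed.\<close>

lemma binary_value_inj:
  assumes "\<And>i. i < m \<Longrightarrow> b i \<le> 1" "\<And>i. i < m \<Longrightarrow> b' i \<le> 1"
    and "binary_value m b = binary_value m b'" "i < m"
  shows "b i = b' i"
  using assms
proof (induction m)
  case (Suc m)
  have "binary_value m b < 2 ^ m" "binary_value m b' < 2 ^ m"
    using Suc.prems by (auto intro!: binary_value_less)
  moreover have "b m \<le> 1" "b' m \<le> 1" using Suc.prems by auto
  ultimately have "b m = b' m" "binary_value m b = binary_value m b'"
    using Suc.prems(3) by (cases "b m"; cases "b' m"; auto simp: binary_value_Suc)+
  then show ?case using Suc by (auto simp: less_Suc_eq)
qed simp

section \<open>From colorings to constraints between components\<close>

lemma proper_2_coloring_iff:
  assumes "simple_graph V E" "X \<subseteq> V"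
  shows "proper_2_coloring E X (V - X) \<longleftrightarrow> (\<forall>u v. {u, v} \<in> E \<longrightarrow> (u \<in> X) \<noteq> (v \<in> X))"
proof
  assume *: "proper_2_coloring E X (V - X)"
  show "\<forall>u v. {u, v} \<in> E \<longrightarrow> (u \<in> X) \<noteq> (v \<in> X)"
  proof (intro allI impI)
    fix u v assume e: "{u, v} \<in> E"
    then have "{u, v} \<subseteq> V" using assms(1) by (auto simp: simple_graph_def)
    moreover have "\<not> {u, v} \<subseteq> X" "\<not> {u, v} \<subseteq> V - X"
      using * e unfolding proper_2_coloring_def independent_set_def by blast+
    ultimately show "(u \<in> X) \<noteq> (v \<in> X)" by auto
  qed
next
  assume *: "\<forall>u v. {u, v} \<in> E \<longrightarrow> (u \<in> X) \<noteq> (v \<in> X)"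
  show "proper_2_coloring E X (V - X)"
    unfolding proper_2_coloring_def independent_set_def
  proof safe
    fix e assume e: "e \<in> E"
    then obtain u v where uv: "e = {u, v}"
      using assms(1) unfolding simple_graph_def by (metis card_2_iff)
    { assume "e \<subseteq> X" then show False using * e uv by auto }
    { assume "e \<subseteq> V - X" then show False using * e uv by auto }
  qed
qed

text \<open>All edges of all samples in one sequence: the \<open>p\<close>-th joins \<open>eu p\<close> and \<open>ev p\<close> in sample \<open>es p\<close>.\<close>

locale edge_list =
  fixes V :: "nat set" and S :: "(nat set set \<times> bool) list" and vs :: "nat list"
    and P :: nat and eu ev es :: "nat \<Rightarrow> nat"
  assumes instance_VS: "conscheck_instance (V, S)"
    and vs: "lists_set vs V"
    and edge: "p < P \<Longrightarrow> es p < length S \<and> {eu p, ev p} \<in> fst (S ! es p)"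
    and edge_cover: "i < length S \<Longrightarrow> e \<in> fst (S ! i) \<Longrightarrow> \<exists>p<P. es p = i \<and> e = {eu p, ev p}"
begin

definition "pos p \<longleftrightarrow> snd (S ! es p)"
definition "Neg = {i. i < length S \<and> \<not> snd (S ! i)}"
definition "k = card Neg"

lemma finite_Neg: "finite Neg"
  by (simp add: Neg_def)

lemma k_eq: "num_negative (V, S) = k"
  by (simp add: num_negative_def k_def Neg_def)

lemma simple: "i < length S \<Longrightarrow> simple_graph V (fst (S ! i))"
  using instance_VS nth_mem[of i S]
  by (cases "S ! i") (auto simp: conscheck_instance_def dest: bspec)

lemma ends: assumes "p < P" shows "eu p \<in> V" "ev p \<in> V" "eu p \<noteq> ev p"
proof -
  have "{eu p, ev p} \<subseteq> V" "card {eu p, ev p} = 2"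
    using edge[OF assms] simple unfolding simple_graph_def by blast+
  then show "eu p \<in> V" "ev p \<in> V" "eu p \<noteq> ev p" by (auto simp: card_insert_if split: if_splits)
qed

lemma es_Neg: "p < P \<Longrightarrow> es p \<in> Neg \<longleftrightarrow> \<not> pos p"
  using edge by (auto simp: Neg_def pos_def)

definition separates :: "nat \<Rightarrow> nat set \<Rightarrow> bool" where
  "separates p X \<longleftrightarrow> (\<forall>q<p. pos q \<longrightarrow> (eu q \<in> X) \<noteq> (ev q \<in> X))"

text \<open>A negative sample demands a monochromatic edge. In particular a negative sample without
  edges can never be met, in accordance with the empty range of \<open>p\<close>.\<close>

lemma consistent_iff:
  assumes "X \<subseteq> V"
  shows "consistent (V, S) X \<longleftrightarrow> separates P X \<and>
    (\<forall>i\<in>Neg. \<exists>p<P. es p = i \<and> (eu p \<in> X) = (ev p \<in> X))"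
proof -
  have proper: "proper_2_coloring (fst (S ! i)) X (V - X) \<longleftrightarrow>
      (\<forall>p<P. es p = i \<longrightarrow> (eu p \<in> X) \<noteq> (ev p \<in> X))" if i: "i < length S" for i
  proof -
    have "(\<forall>u v. {u, v} \<in> fst (S ! i) \<longrightarrow> (u \<in> X) \<noteq> (v \<in> X)) \<longleftrightarrow>
      (\<forall>p<P. es p = i \<longrightarrow> (eu p \<in> X) \<noteq> (ev p \<in> X))"
    proof (intro iffI allI impI)
      fix u v assume *: "\<forall>p<P. es p = i \<longrightarrow> (eu p \<in> X) \<noteq> (ev p \<in> X)" "{u, v} \<in> fst (S ! i)"
      obtain p where "p < P" "es p = i" "{u, v} = {eu p, ev p}"
        using edge_cover[OF i *(2)] by auto
      then show "(u \<in> X) \<noteq> (v \<in> X)" using *(1) by (auto simp: doubleton_eq_iff)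
    next
      fix p assume "\<forall>u v. {u, v} \<in> fst (S ! i) \<longrightarrow> (u \<in> X) \<noteq> (v \<in> X)" "p < P" "es p = i"
      then show "(eu p \<in> X) \<noteq> (ev p \<in> X)" using edge by blast
    qed
    then show ?thesis using proper_2_coloring_iff[OF simple[OF i] assms] by simp
  qed
  have "consistent (V, S) X \<longleftrightarrow> (\<forall>i<length S.
      (\<forall>p<P. es p = i \<longrightarrow> (eu p \<in> X) \<noteq> (ev p \<in> X)) \<longleftrightarrow> snd (S ! i))"
    using assms proper by (simp add: consistent_def)
  also have "\<dots> \<longleftrightarrow> separates P X \<and> (\<forall>i\<in>Neg. \<exists>p<P. es p = i \<and> (eu p \<in> X) = (ev p \<in> X))"
    unfolding separates_def pos_def Neg_def using edge by auto
  finally show ?thesis .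
qed

text \<open>
  \<open>C\<close> assigns components and \<open>K\<close> relative colors to the vertices, as forced by the positive edges
  among the first \<open>p\<close>; \<open>f > 0\<close> records that these contain an odd cycle.
\<close>

definition merge_inv :: "nat \<Rightarrow> (nat \<Rightarrow> nat) \<Rightarrow> (nat \<Rightarrow> nat) \<Rightarrow> nat \<Rightarrow> bool" where
  "merge_inv p C K f \<longleftrightarrow> (\<forall>w\<in>V. K w \<le> 1) \<and>
     (\<forall>q<p. pos q \<longrightarrow> C (eu q) = C (ev q) \<and> (f = 0 \<longrightarrow> K (eu q) \<noteq> K (ev q))) \<and>
     (\<forall>X. separates p X \<longrightarrow> f = 0 \<and>
        (\<forall>w\<in>V. \<forall>w'\<in>V. C w = C w' \<longrightarrow> (((w \<in> X) = (w' \<in> X)) = (K w = K w'))))"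

text \<open>Every vertex starts as its own component. The default 0 off \<open>V\<close> matches
  array \<open>aC\<close> after the vertices have been read.\<close>

lemma merge_inv_0: "merge_inv 0 (\<lambda>w. if w \<in> V then w else 0) (\<lambda>_. 0) 0"
  by (auto simp: merge_inv_def)

lemma separates_Suc:
  "separates (Suc p) X \<longleftrightarrow> separates p X \<and> (pos p \<longrightarrow> (eu p \<in> X) \<noteq> (ev p \<in> X))"
  by (auto simp: separates_def less_Suc_eq)

lemma merge_inv_skip: "merge_inv p C K f \<Longrightarrow> \<not> pos p \<Longrightarrow> merge_inv (Suc p) C K f"
  unfolding merge_inv_def separates_Suc less_Suc_eq by auto

text \<open>Inside a component relative colors decide which vertices are separated, so an edge
  between equal relative colors closes an odd cycle and refutes every \<open>X\<close>.\<close>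

lemma merge_inv_same:
  assumes "merge_inv p C K f" "p < P" "pos p" "C (eu p) = C (ev p)"
  shows "merge_inv (Suc p) C K (f + of_bool (K (eu p) = K (ev p)))"
proof -
  have "K (eu p) \<noteq> K (ev p)" if "separates (Suc p) X" for X
    using that assms ends[OF assms(2)] unfolding merge_inv_def separates_Suc by blast
  then show ?thesis
    using assms unfolding merge_inv_def separates_Suc less_Suc_eq by auto
qed

text \<open>The component of \<open>ev p\<close> is absorbed by that of \<open>eu p\<close>. Its
  relative colors are complemented exactly if the new edge would otherwise join equal ones.\<close>

lemma merge_inv_merge:
  assumes inv: "merge_inv p C K f" and p: "p < P" "pos p" and "C (eu p) \<noteq> C (ev p)"
    and C': "C' = (\<lambda>w. if w \<in> V \<and> C w = C (ev p) then C (eu p) else C w)"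
    and K': "K' = (\<lambda>w. if w \<in> V \<and> C w = C (ev p) \<and> K (eu p) = K (ev p) then 1 - K w else K w)"
  shows "merge_inv (Suc p) C' K' f"
proof -
  have K1: "\<And>w. w \<in> V \<Longrightarrow> K w \<le> 1" using inv by (auto simp: merge_inv_def)
  have 1: "C' (eu q) = C' (ev q) \<and> (f = 0 \<longrightarrow> K' (eu q) \<noteq> K' (ev q))" if q: "q < Suc p" "pos q" for q
  proof (cases "q = p")
    case True
    have "K (ev p) \<noteq> 1 - K (ev p)" using K1[of "ev p"] ends[OF p(1)] by (cases "K (ev p)") auto
    then show ?thesis using True ends[OF p(1)] assms(4) unfolding C' K' by auto
  next
    case False
    then have "q < p" "q < P" using q p by auto
    then have "C (eu q) = C (ev q)" "f = 0 \<longrightarrow> K (eu q) \<noteq> K (ev q)"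
      using inv q by (auto simp: merge_inv_def)
    then show ?thesis
      using ends[OF \<open>q < P\<close>] K1[of "ev q"] K1[of "eu q"] unfolding C' K' by auto
  qed
  have 2: "f = 0 \<and> (\<forall>w\<in>V. \<forall>w'\<in>V. C' w = C' w' \<longrightarrow> (((w \<in> X) = (w' \<in> X)) = (K' w = K' w')))"
    if X: "separates (Suc p) X" for X
  proof -
    have sep: "separates p X" "(eu p \<in> X) \<noteq> (ev p \<in> X)" using X p by (auto simp: separates_Suc)
    have old: "f = 0" "\<And>w w'. w \<in> V \<Longrightarrow> w' \<in> V \<Longrightarrow> C w = C w' \<Longrightarrow>
        ((w \<in> X) = (w' \<in> X)) = (K w = K w')"
      using inv sep(1) by (auto simp: merge_inv_def)
    have bit: "K x = 0 \<or> K x = 1" if "x \<in> V" for x using K1[OF that] by auto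
    \<comment> \<open>Only pairs across the two merged components are new. Each vertex is compared
      with the end of edge \<open>p\<close> in its old component, and that edge separates the two
      ends.\<close>
    have cross: "((w \<in> X) = (w' \<in> X)) = (K' w = K' w')"
      if w: "w \<in> V" "w' \<in> V" "C w = C (ev p)" "C w' = C (eu p)" for w w'
    proof -
      have "((w \<in> X) = (ev p \<in> X)) = (K w = K (ev p))" "((w' \<in> X) = (eu p \<in> X)) = (K w' = K (eu p))"
        using old(2) w ends[OF p(1)] by auto
      moreover have "K' w = (if K (eu p) = K (ev p) then 1 - K w else K w)" "K' w' = K w'"
        using w assms(4) by (auto simp: K')
      ultimately show ?thesis
        using sep(2) bit[OF w(1)] bit[OF w(2)] bit[OF ends(1)[OF p(1)]] bit[OF ends(2)[OF p(1)]]
        by (elim disjE) simp_all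
    qed
    have "((w \<in> X) = (w' \<in> X)) = (K' w = K' w')" if w: "w \<in> V" "w' \<in> V" "C' w = C' w'" for w w'
    proof (cases "C w = C w'")
      case True
      then have "((w \<in> X) = (w' \<in> X)) = (K w = K w')" using old(2) w by blast
      moreover have "(K' w = K' w') = (K w = K w')"
        using True w(1,2) bit[OF w(1)] bit[OF w(2)] by (auto simp: K')
      ultimately show ?thesis by simp
    next
      case False
      then have "C w = C (ev p) \<and> C w' = C (eu p) \<or> C w' = C (ev p) \<and> C w = C (eu p)"
        using w by (auto simp: C' split: if_splits)
      then show ?thesis using cross[of w w'] cross[of w' w] w by (metis (no_types))
    qed
    then show ?thesis using old(1) by blast
  qed
  have "\<forall>w\<in>V. K' w \<le> 1" using K1 by (auto simp: K')
  then show ?thesis using 1 2 unfolding merge_inv_def by blast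
qed

text \<open>After flipping, an edge is monochromatic iff equality of the two flips coincides with
  equality of the relative colors of its ends.\<close>

definition constraints :: "(nat \<Rightarrow> nat) \<Rightarrow> (nat \<Rightarrow> nat) \<Rightarrow> nat \<Rightarrow> (nat \<times> nat \<times> bool) set" where
  "constraints C K i = {(C (eu p), C (ev p), K (eu p) = K (ev p)) | p. p < P \<and> es p = i}"

definition colored :: "(nat \<Rightarrow> nat) \<Rightarrow> (nat \<Rightarrow> nat) \<Rightarrow> (nat \<Rightarrow> bool) \<Rightarrow> nat set" where
  "colored C K \<phi> = {w \<in> V. (K w = 1) \<noteq> \<phi> (C w)}"

lemma consistent_colored:
  assumes "merge_inv P C K 0" "\<forall>i\<in>Neg. \<exists>x\<in>constraints C K i. agrees \<phi> x"
  shows "consistent (V, S) (colored C K \<phi>)"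
proof -
  have bit: "K x = 0 \<or> K x = 1" if "x \<in> V" for x
    using assms(1) that by (auto simp: merge_inv_def le_Suc_eq)
  have "separates P (colored C K \<phi>)"
    unfolding separates_def
  proof (intro allI impI)
    fix q assume q: "q < P" "pos q"
    then have "C (eu q) = C (ev q)" "K (eu q) \<noteq> K (ev q)"
      using assms(1) by (auto simp: merge_inv_def)
    then show "(eu q \<in> colored C K \<phi>) \<noteq> (ev q \<in> colored C K \<phi>)"
      using ends[OF q(1)] bit[of "eu q"] bit[of "ev q"] by (auto simp: colored_def)
  qed
  moreover have "\<exists>p<P. es p = i \<and> (eu p \<in> colored C K \<phi>) = (ev p \<in> colored C K \<phi>)"
    if i: "i \<in> Neg" for i
  proof -
    obtain p where p: "p < P" "es p = i" "(\<phi> (C (eu p)) = \<phi> (C (ev p))) = (K (eu p) = K (ev p))"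
      using assms(2) i by (fastforce simp: constraints_def agrees_def)
    then have "(eu p \<in> colored C K \<phi>) = (ev p \<in> colored C K \<phi>)"
      using ends[OF p(1)] bit[of "eu p"] bit[of "ev p"] by (auto simp: colored_def)
    then show ?thesis using p by blast
  qed
  ultimately show ?thesis
    by (subst consistent_iff) (auto simp: colored_def)
qed

lemma consistent_imp_agrees:
  assumes "merge_inv P C K f" "consistent (V, S) X"
  shows "f = 0" "\<exists>\<phi>. \<forall>i\<in>Neg. \<exists>x\<in>constraints C K i. agrees \<phi> x"
proof -
  have XV: "X \<subseteq> V" using assms(2) by (simp add: consistent_def)
  have sep: "separates P X" and neg: "\<forall>i\<in>Neg. \<exists>p<P. es p = i \<and> (eu p \<in> X) = (ev p \<in> X)"
    using assms(2) consistent_iff[OF XV] by auto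
  show "f = 0" using assms(1) sep by (auto simp: merge_inv_def)
  have rel: "((w \<in> X) = (w' \<in> X)) = (K w = K w')" if "w \<in> V" "w' \<in> V" "C w = C w'" for w w'
    using assms(1) sep that by (auto simp: merge_inv_def)
  have bit: "K x = 0 \<or> K x = 1" if "x \<in> V" for x
    using assms(1) that by (auto simp: merge_inv_def le_Suc_eq)
  \<comment> \<open>A component is flipped if \<open>X\<close> is the complement of the relative
    coloring on it; by \<open>rel\<close> every vertex of the component gives the same
    verdict.\<close>
  define \<phi> where "\<phi> c \<longleftrightarrow> (\<exists>w\<in>V. C w = c \<and> (w \<in> X) \<noteq> (K w = 1))" for c
  have \<phi>: "\<phi> (C w) \<longleftrightarrow> (w \<in> X) \<noteq> (K w = 1)" if "w \<in> V" for w
    unfolding \<phi>_def using rel[OF that] bit[OF that] bit that by (metis zero_neq_one)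
  have "\<exists>x\<in>constraints C K i. agrees \<phi> x" if i: "i \<in> Neg" for i
  proof -
    obtain p where p: "p < P" "es p = i" "(eu p \<in> X) = (ev p \<in> X)" using neg i by blast
    have "agrees \<phi> (C (eu p), C (ev p), K (eu p) = K (ev p))"
      using p(3) \<phi> ends[OF p(1)] bit[of "eu p"] bit[of "ev p"] by (auto simp: agrees_def)
    then show ?thesis using p by (auto simp: constraints_def)
  qed
  then show "\<exists>\<phi>. \<forall>i\<in>Neg. \<exists>x\<in>constraints C K i. agrees \<phi> x" by blast
qed

end

section \<open>The program\<close>

abbreviation (input) vN :: nat where "vN \<equiv> 2"
abbreviation (input) vT :: nat where "vT \<equiv> 3"
abbreviation (input) vK :: nat where "vK \<equiv> 4"
abbreviation (input) vP :: nat where "vP \<equiv> 5"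
abbreviation (input) vI :: nat where "vI \<equiv> 6"
abbreviation (input) vD :: nat where "vD \<equiv> 7"
abbreviation (input) vJ :: nat where "vJ \<equiv> 8"
abbreviation (input) vE :: nat where "vE \<equiv> 9"
abbreviation (input) vL :: nat where "vL \<equiv> 10"
abbreviation (input) vM :: nat where "vM \<equiv> 11"
abbreviation (input) vU :: nat where "vU \<equiv> 12"
abbreviation (input) vV :: nat where "vV \<equiv> 13"
abbreviation (input) vA :: nat where "vA \<equiv> 14"
abbreviation (input) vB :: nat where "vB \<equiv> 15"
abbreviation (input) vX :: nat where "vX \<equiv> 16"
abbreviation (input) vY :: nat where "vY \<equiv> 17"
abbreviation (input) vZ :: nat where "vZ \<equiv> 18"
abbreviation (input) vF :: nat where "vF \<equiv> 19"
abbreviation (input) vMu :: nat where "vMu \<equiv> 20"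
abbreviation (input) vK2 :: nat where "vK2 \<equiv> 21"
abbreviation (input) vIt :: nat where "vIt \<equiv> 22"
abbreviation (input) vCnt :: nat where "vCnt \<equiv> 23"
abbreviation (input) vGo :: nat where "vGo \<equiv> 24"
abbreviation (input) vCarry :: nat where "vCarry \<equiv> 25"
abbreviation (input) vFound :: nat where "vFound \<equiv> 26"
abbreviation (input) vOne :: nat where "vOne \<equiv> 27"

text \<open>
  The \<open>p\<close>-th edge read joins \<open>aEU[p]\<close> and \<open>aEV[p]\<close> in sample \<open>aES[p]\<close>, which has label \<open>aEL[p]\<close>. A vertex
  \<open>v\<close> lies in component \<open>aC[v]\<close> and has color \<open>aCol[v]\<close> relative to it. For a component \<open>c\<close>, \<open>aM[c]\<close> tells
  whether it is marked and \<open>aFl[c]\<close> whether it is flipped; \<open>aML\<close> lists the marked components. For a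
  sample \<open>i\<close>, \<open>aCT[i]\<close> is the used budget and \<open>aSat[i]\<close> the last trial that satisfied it.
\<close>

abbreviation (input) aVS :: nat where "aVS \<equiv> 2"
abbreviation (input) aEU :: nat where "aEU \<equiv> 3"
abbreviation (input) aEV :: nat where "aEV \<equiv> 4"
abbreviation (input) aES :: nat where "aES \<equiv> 5"
abbreviation (input) aEL :: nat where "aEL \<equiv> 6"
abbreviation (input) aC :: nat where "aC \<equiv> 7"
abbreviation (input) aCol :: nat where "aCol \<equiv> 8"
abbreviation (input) aM :: nat where "aM \<equiv> 9"
abbreviation (input) aML :: nat where "aML \<equiv> 10"
abbreviation (input) aCT :: nat where "aCT \<equiv> 11"
abbreviation (input) aFl :: nat where "aFl \<equiv> 12"
abbreviation (input) aSat :: nat where "aSat \<equiv> 13"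

section \<open>Merging components along positive edges\<close>

definition relabel :: com where
  "relabel = For vJ vE vN (
     Op (Get vZ aVS vJ) ;; Op (Get vM aC vZ) ;; Op (Dist vM vM vB) ;;
     If vM Skip
       (Op (Put aC vZ vA) ;; Op (Get vM aCol vZ) ;; Op (Dist vM vM vX) ;; Op (Put aCol vZ vM)))"

text \<open>Scalar \<open>vX\<close> becomes 1 iff the ends have equal relative colors. It serves as
  the amount to flip when two components merge, and as the odd-cycle count added to
  \<open>vF\<close> otherwise.\<close>

definition merge_code :: com where
  "merge_code = For vI vD vP (
     Op (Get vL aEL vI) ;;
     If vL
       (Op (Get vU aEU vI) ;; Op (Get vV aEV vI) ;; Op (Get vA aC vU) ;; Op (Get vB aC vV) ;;
        Op (Get vX aCol vU) ;; Op (Get vY aCol vV) ;; Op (Dist vX vX vY) ;;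
        Op (Const vOne 1) ;; Op (Dist vX vX vOne) ;; Op (Dist vY vA vB) ;;
        If vY relabel (Op (Add vF vF vX)))
       Skip)"

context edge_list
begin

definition static :: "store \<Rightarrow> bool" where
  "static s \<longleftrightarrow> sc s vN = length vs \<and> sc s vP = P \<and> sc s vK = k \<and>
     (\<forall>i<length vs. ar s aVS i = vs ! i) \<and> ar s aEU = eu \<and> ar s aEV = ev \<and> ar s aES = es \<and>
     (\<forall>p<P. ar s aEL p = of_bool (pos p)) \<and> outs s = []"

lemma static_P: "static s \<Longrightarrow> sc s vP = P"
  by (simp add: static_def)

text \<open>The zeros that marking and search rely on; merging leaves them alone.\<close>

definition fresh :: "store \<Rightarrow> bool" where
  "fresh s \<longleftrightarrow> sc s vMu = 0 \<and> sc s vIt = 0 \<and> ar s aM = (\<lambda>_. 0) \<and> ar s aCT = (\<lambda>_. 0) \<and>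
     ar s aFl = (\<lambda>_. 0) \<and> ar s aSat = (\<lambda>_. 0)"

lemma distinct_vs: "distinct vs" "set vs = V"
  using vs by (auto simp: lists_set_def)

lemma take_Suc_vs: "j < length vs \<Longrightarrow> set (take (Suc j) vs) = insert (vs ! j) (set (take j vs))"
  by (simp add: take_Suc_conv_app_nth)

lemma nth_notin_take: "j < length vs \<Longrightarrow> vs ! j \<notin> set (take j vs)"
  using distinct_vs(1) by (auto simp: in_set_conv_nth nth_eq_iff_index_eq)

lemma wpt_relabel:
  assumes "static s" "fresh s"
  shows "wpt relabel (length vs * 55 + 5)
    (\<lambda>s'. static s' \<and> fresh s' \<and> sc s' vF = sc s vF \<and> sc s' vI = sc s vI \<and>
       ar s' aC = (\<lambda>w. if w \<in> V \<and> ar s aC w = sc s vB then sc s vA else ar s aC w) \<and>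
       ar s' aCol = (\<lambda>w. if w \<in> V \<and> ar s aC w = sc s vB
          then gap (ar s aCol w) (sc s vX) else ar s aCol w)) s"
  unfolding relabel_def
proof (rule wpt_mono[OF wpt_For[where C = 49 and N = "length vs" and I = "\<lambda>j s'. static s' \<and> fresh s' \<and>
    sc s' vA = sc s vA \<and> sc s' vB = sc s vB \<and> sc s' vX = sc s vX \<and>
    sc s' vF = sc s vF \<and> sc s' vI = sc s vI \<and>
    ar s' aC = (\<lambda>w. if w \<in> set (take j vs) \<and> ar s aC w = sc s vB then sc s vA else ar s aC w) \<and>
    ar s' aCol = (\<lambda>w. if w \<in> set (take j vs) \<and> ar s aC w = sc s vB
          then gap (ar s aCol w) (sc s vX) else ar s aCol w)"]], goal_cases)
  case (1 j s')
  then show ?case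
    \<comment> \<open>As the vertices are listed without repetition, the entries of
      \<open>vs ! j\<close> still have their original values when it is visited.\<close>
    using nth_notin_take[of j]
    by (auto simp: exec_simps static_def fresh_def take_Suc_vs fun_eq_iff)
qed (use assms in \<open>auto simp: static_def fresh_def distinct_vs\<close>)

definition merged :: "nat \<Rightarrow> store \<Rightarrow> bool" where
  "merged p s \<longleftrightarrow> static s \<and> fresh s \<and> merge_inv p (ar s aC) (ar s aCol) (sc s vF)"

lemma wpt_merge_code:
  assumes "merged 0 s"
  shows "wpt merge_code (P * (length vs * 55 + 90) + 5) (merged P) s"
  unfolding merge_code_def
proof (rule wpt_mono[OF wpt_For[where C = "length vs * 55 + 80" and N = P and I = merged]], goal_cases)
  case (1 p s)
  let ?C = "ar s aC" and ?K = "ar s aCol"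
  have inv: "static s" "fresh s" "merge_inv p ?C ?K (sc s vF)" using 1 by (auto simp: merged_def)
  have K1: "?K (eu p) \<le> 1" "?K (ev p) \<le> 1"
    using inv(3) ends[OF 1(1)] by (auto simp: merge_inv_def)
  show ?case
  proof (cases "pos p")
    case False
    then show ?thesis
      using 1 inv merge_inv_skip[OF inv(3) False]
      by (auto simp: exec_simps static_def fresh_def merged_def)
  next
    case True
    show ?thesis
    proof (cases "?C (eu p) = ?C (ev p)")
      case same: True
      have "?K (eu p) = 0 \<or> ?K (eu p) = 1" "?K (ev p) = 0 \<or> ?K (ev p) = 1" using K1 by auto
      then show ?thesis
        using 1 inv merge_inv_same[OF inv(3) 1(1) True same] same True
        by (auto simp: exec_simps static_def fresh_def merged_def)
    next
      case False
      let ?x = "of_bool (?K (eu p) = ?K (ev p)) :: nat"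
      have "?K (eu p) = 0 \<or> ?K (eu p) = 1" "?K (ev p) = 0 \<or> ?K (ev p) = 1" using K1 by auto
      then have x: "gap (gap (?K (eu p)) (?K (ev p))) (Suc 0) = ?x" by (auto simp: gap_def)
      \<comment> \<open>Exclusive or with \<open>?x\<close> is the conditional complement in
        \<open>merge_inv_merge\<close>, since relative colors on \<open>V\<close> are bits.\<close>
      have col: "(\<lambda>w. if w \<in> V \<and> ?C w = ?C (ev p) then gap (?K w) ?x else ?K w) =
         (\<lambda>w. if w \<in> V \<and> ?C w = ?C (ev p) \<and> ?K (eu p) = ?K (ev p) then 1 - ?K w else ?K w)"
        using inv(3) by (auto simp: fun_eq_iff merge_inv_def gap_def)
      note step = merge_inv_merge[OF inv(3) 1(1) True False refl refl, folded col]
      have "wpt relabel (19 + length vs * 55) (\<lambda>s'. merged (Suc p) s' \<and> sc s' vI = p \<and> sc s' vP = P) t"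
        if "static t" "fresh t" "sc t vA = ?C (eu p)" "sc t vB = ?C (ev p)" "sc t vX = ?x"
          "sc t vF = sc s vF" "sc t vI = p" "ar t aC = ?C" "ar t aCol = ?K" for t
        by (rule wpt_mono[OF wpt_relabel[OF that(1,2)]]) (simp_all add: that step merged_def static_P cong: if_cong)
      then show ?thesis
        using 1 True False inv x by (simp add: exec_simps static_def fresh_def)
    qed
  qed
qed (use assms in \<open>auto simp: merged_def static_def fresh_def\<close>)

end

section \<open>Marking components within the budgets\<close>

definition mark_one :: "nat \<Rightarrow> com" where
  "mark_one x = Op (Get vA aM x) ;;
     If vA Skip
       (Op (Const vOne 1) ;; Op (Put aM x vOne) ;; Op (Put aML vMu x) ;; Op (AddC vMu vMu 1))"

text \<open>Three tests are precomputed: \<open>vX\<close> is positive iff the components differ,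
  \<open>vZ\<close> iff budget is left, and \<open>vM\<close>, which is 2 minus the number of marked
  ends, iff not both are marked.\<close>

definition mark_step :: com where
  "mark_step = Op (Get vL aEL vI) ;;
     If vL Skip
       (Op (Get vU aEU vI) ;; Op (Get vU aC vU) ;; Op (Get vV aEV vI) ;; Op (Get vV aC vV) ;;
        Op (Dist vX vU vV) ;; Op (Get vL aES vI) ;; Op (Get vY aCT vL) ;; Op (Sub vZ vK2 vY) ;;
        Op (Get vA aM vU) ;; Op (Get vB aM vV) ;; Op (Add vA vA vB) ;; Op (Const vB 2) ;;
        Op (Sub vM vB vA) ;;
        If vX
          (If vZ
            (If vM
              (Op (AddC vY vY 1) ;; Op (Put aCT vL vY) ;; mark_one vU ;; mark_one vV)
              Skip)
            Skip)
          Skip)"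

definition mark_code :: com where
  "mark_code = Op (Add vK2 vK vK) ;; For vI vD vP mark_step"

text \<open>A repetition-free list is required because its positions later become the digits of a
  binary counter.\<close>

definition marks :: "nat set \<Rightarrow> store \<Rightarrow> bool" where
  "marks Ms s \<longleftrightarrow> finite Ms \<and> ar s aM = (\<lambda>c. of_bool (c \<in> Ms)) \<and>
     bij_betw (ar s aML) {..<sc s vMu} Ms"

lemma wpt_mark_one:
  assumes "marks Ms s" "x \<notin> {vA, vOne, vMu}"
  shows "wpt (mark_one x) 30 (\<lambda>s'. marks (insert (sc s x) Ms) s' \<and>
     (\<forall>y. y \<notin> {vA, vOne, vMu, 30} \<longrightarrow> sc s' y = sc s y) \<and>
     (\<forall>j. j \<notin> {aM, aML} \<longrightarrow> ar s' j = ar s j) \<and> outs s' = outs s) s"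
proof (cases "sc s x \<in> Ms")
  case True
  then show ?thesis
    using assms unfolding mark_one_def marks_def by (simp add: exec_simps insert_absorb)
next
  case False
  let ?f = "ar s aML" and ?m = "sc s vMu"
  have "bij_betw (?f(?m := sc s x)) {..<?m} Ms"
    using assms(1) bij_betw_cong[of "{..<?m}" ?f "?f(?m := sc s x)" Ms] by (simp add: marks_def)
  then have "bij_betw (?f(?m := sc s x)) {..<Suc ?m} (insert (sc s x) Ms)"
    using False notIn_Un_bij_betw[of ?m "{..<?m}" "?f(?m := sc s x)" Ms] by (simp add: lessThan_Suc)
  then show ?thesis
    using assms False unfolding mark_one_def marks_def by (simp add: exec_simps fun_eq_iff)
qed

context edge_list
begin

text \<open>The first bound on \<open>card Ms\<close> yields \<open>4 * (k * k)\<close> and hence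
  the number of trials; the second keeps the cost of a trial polynomial. The final disjunction
  separates exhausted samples from those all of whose edges so far are harmless.\<close>

definition mark_inv :: "(nat \<Rightarrow> nat) \<Rightarrow> (nat \<Rightarrow> nat) \<Rightarrow> nat \<Rightarrow> nat set \<Rightarrow> (nat \<Rightarrow> nat) \<Rightarrow> bool" where
  "mark_inv C K p Ms ct \<longleftrightarrow> finite Ms \<and> card Ms \<le> 2 * (\<Sum>i\<in>Neg. ct i) \<and> card Ms \<le> 2 * p \<and>
     (\<forall>i\<in>Neg. ct i \<le> 2 * k \<and> many_choices (ct i) Ms (constraints C K i) \<and>
        (ct i = 2 * k \<or> (\<forall>q<p. es q = i \<longrightarrow>
           C (eu q) = C (ev q) \<or> C (eu q) \<in> Ms \<and> C (ev q) \<in> Ms)))"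

lemma mark_inv_0: "mark_inv C K 0 {} (\<lambda>_. 0)"
  by (auto simp: mark_inv_def many_choices_def intro!: exI[of _ "{}"])

lemma mark_inv_skip:
  assumes "mark_inv C K p Ms ct" "p < P"
    and "pos p \<or> C (eu p) = C (ev p) \<or> C (eu p) \<in> Ms \<and> C (ev p) \<in> Ms \<or> 2 * k \<le> ct (es p)"
  shows "mark_inv C K (Suc p) Ms ct"
proof -
  have "ct i = 2 * k \<or> (\<forall>q<Suc p. es q = i \<longrightarrow>
      C (eu q) = C (ev q) \<or> C (eu q) \<in> Ms \<and> C (ev q) \<in> Ms)" if i: "i \<in> Neg" for i
  proof (cases "ct i = 2 * k")
    case False
    have "ct i \<le> 2 * k" using assms(1) i by (simp add: mark_inv_def)
    then have "es p = i \<longrightarrow> C (eu p) = C (ev p) \<or> C (eu p) \<in> Ms \<and> C (ev p) \<in> Ms"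
      using assms(3) es_Neg[OF assms(2)] i False by auto
    then show ?thesis using assms(1) i False by (auto simp: mark_inv_def less_Suc_eq)
  qed simp
  then show ?thesis using assms(1) by (simp add: mark_inv_def)
qed

lemma many_choices_mono:
  assumes "many_choices m M A" "M \<subseteq> M'"
  shows "many_choices m M' A"
proof -
  obtain W where W: "finite W" "card W = m"
    "\<forall>c\<in>W. \<exists>d b. ((c, d, b) \<in> A \<or> (d, c, b) \<in> A) \<and> c \<noteq> d \<and> c \<in> M \<and> d \<in> M"
    using assms(1) unfolding many_choices_def by (elim exE conjE)
  have "\<forall>c\<in>W. \<exists>d b. ((c, d, b) \<in> A \<or> (d, c, b) \<in> A) \<and> c \<noteq> d \<and> c \<in> M' \<and> d \<in> M'"
    using W(3) assms(2) by (meson subsetD)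
  then show ?thesis unfolding many_choices_def using W(1,2) by (intro exI conjI)
qed

text \<open>All earlier own components lie in \<open>M\<close>, so an unmarked \<open>c\<close> is a
  genuinely new element of \<open>W\<close>.\<close>

lemma many_choices_insert:
  assumes "many_choices m M A" "c \<notin> M" "c \<noteq> d" "(c, d, b) \<in> A \<or> (d, c, b) \<in> A"
    and "M \<subseteq> M'" "c \<in> M'" "d \<in> M'"
  shows "many_choices (Suc m) M' A"
proof -
  obtain W where W: "finite W" "card W = m"
    "\<forall>c\<in>W. \<exists>d b. ((c, d, b) \<in> A \<or> (d, c, b) \<in> A) \<and> c \<noteq> d \<and> c \<in> M \<and> d \<in> M"
    using assms(1) unfolding many_choices_def by (elim exE conjE)
  have "c \<notin> W" using W(3) assms(2) by blast
  then have "finite (insert c W)" "card (insert c W) = Suc m" using W by simp_all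
  moreover have "\<forall>c\<in>W. \<exists>d b. ((c, d, b) \<in> A \<or> (d, c, b) \<in> A) \<and> c \<noteq> d \<and> c \<in> M' \<and> d \<in> M'"
    using W(3) assms(5) by (meson subsetD)
  moreover have "\<exists>d b. ((c, d, b) \<in> A \<or> (d, c, b) \<in> A) \<and> c \<noteq> d \<and> c \<in> M' \<and> d \<in> M'"
    using assms(3,4,6,7) by blast
  ultimately show ?thesis
    unfolding many_choices_def by (intro exI[of _ "insert c W"]) simp
qed

text \<open>At least one end is unmarked and becomes the additional own component paid for by one
  unit of budget; at most two components are marked for that unit.\<close>

lemma mark_inv_mark:
  assumes inv: "mark_inv C K p Ms ct" and p: "p < P" "\<not> pos p" and ne: "C (eu p) \<noteq> C (ev p)"
    and new: "\<not> (C (eu p) \<in> Ms \<and> C (ev p) \<in> Ms)" and budget: "ct (es p) < 2 * k"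
  shows "mark_inv C K (Suc p) (insert (C (ev p)) (insert (C (eu p)) Ms))
    (ct(es p := Suc (ct (es p))))"
proof -
  let ?M = "insert (C (ev p)) (insert (C (eu p)) Ms)" and ?ct = "ct(es p := Suc (ct (es p)))"
  have neg: "es p \<in> Neg" using es_Neg[OF p(1)] p(2) by simp
  have "(\<Sum>i\<in>Neg. ?ct i) = Suc (\<Sum>i\<in>Neg. ct i)"
    using finite_Neg neg by (simp add: sum.remove[OF finite_Neg neg])
  moreover have "card ?M \<le> card Ms + 2"
    using inv by (auto simp: mark_inv_def card_insert_if)
  moreover have "many_choices (?ct i) ?M (constraints C K i)" if i: "i \<in> Neg" for i
  proof (cases "i = es p")
    case True
    have con: "(C (eu p), C (ev p), K (eu p) = K (ev p)) \<in> constraints C K (es p)"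
      using p(1) by (auto simp: constraints_def)
    have old: "many_choices (ct (es p)) Ms (constraints C K (es p))"
      using inv neg by (auto simp: mark_inv_def)
    show ?thesis
    proof (cases "C (eu p) \<in> Ms")
      case False
      then show ?thesis
        using many_choices_insert[OF old False ne disjI1[OF con], of ?M] True by auto
    next
      case True': True
      then have "C (ev p) \<notin> Ms" using new by blast
      then show ?thesis
        using many_choices_insert[OF old _ ne[symmetric] disjI2[OF con], of ?M] True by auto
    qed
  next
    case False
    then show ?thesis
      using inv i many_choices_mono[of "ct i" Ms _ ?M] by (auto simp: mark_inv_def)
  qed
  ultimately show ?thesis
    using inv budget unfolding mark_inv_def less_Suc_eq by auto
qed

lemma mark_inv_card:
  assumes "mark_inv C K p Ms ct"
  shows "card Ms \<le> 4 * (k * k)"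
proof -
  have "(\<Sum>i\<in>Neg. ct i) \<le> (\<Sum>i\<in>Neg. 2 * k)"
    using assms by (intro sum_mono) (auto simp: mark_inv_def)
  then show ?thesis using assms by (auto simp: mark_inv_def k_def)
qed

lemma mark_inv_solution:
  assumes "mark_inv C K P Ms ct" "\<forall>i\<in>Neg. \<exists>x\<in>constraints C K i. agrees \<phi> x"
  shows "\<exists>\<psi>. {c. \<psi> c} \<subseteq> Ms \<and> (\<forall>i\<in>Neg. \<exists>x\<in>constraints C K i. agrees \<psi> x)"
proof (rule supported_solution_exists[OF finite_Neg])
  fix i assume i: "i \<in> Neg"
  then show "(\<forall>x\<in>constraints C K i. supported Ms x) \<or>
      many_choices (2 * card Neg) Ms (constraints C K i)"
    using assms(1) unfolding mark_inv_def constraints_def supported_def k_def by fastforce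
qed (use assms(2) in blast)

definition marking :: "(nat \<Rightarrow> nat) \<Rightarrow> (nat \<Rightarrow> nat) \<Rightarrow> nat \<Rightarrow> store \<Rightarrow> bool" where
  "marking C K p s \<longleftrightarrow> static s \<and> ar s aC = C \<and> ar s aCol = K \<and> sc s vK2 = 2 * k \<and>
     sc s vIt = 0 \<and> ar s aFl = (\<lambda>_. 0) \<and> ar s aSat = (\<lambda>_. 0) \<and>
     (\<exists>Ms. marks Ms s \<and> mark_inv C K p Ms (ar s aCT))"

lemma wpt_mark_pair:
  assumes "marks Ms s"
  shows "wpt (mark_one vU ;; mark_one vV) 60
    (\<lambda>s'. marks (insert (sc s vV) (insert (sc s vU) Ms)) s' \<and>
      (\<forall>y. y \<notin> {vA, vOne, vMu, 30} \<longrightarrow> sc s' y = sc s y) \<and>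
      (\<forall>j. j \<notin> {aM, aML} \<longrightarrow> ar s' j = ar s j) \<and> outs s' = outs s) s"
proof (rule wpt_Seq[where ?T1.0 = 30 and ?T2.0 = 30, OF wpt_mono[OF wpt_mark_one[OF assms] order_refl]])
  fix s1 assume *: "marks (insert (sc s vU) Ms) s1 \<and>
     (\<forall>y. y \<notin> {vA, vOne, vMu, 30} \<longrightarrow> sc s1 y = sc s y) \<and>
     (\<forall>j. j \<notin> {aM, aML} \<longrightarrow> ar s1 j = ar s j) \<and> outs s1 = outs s"
  then show "wpt (mark_one vV) 30 (\<lambda>s'. marks (insert (sc s vV) (insert (sc s vU) Ms)) s' \<and>
      (\<forall>y. y \<notin> {vA, vOne, vMu, 30} \<longrightarrow> sc s' y = sc s y) \<and>
      (\<forall>j. j \<notin> {aM, aML} \<longrightarrow> ar s' j = ar s j) \<and> outs s' = outs s) s1"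
    by (intro wpt_mono[OF wpt_mark_one[of "insert (sc s vU) Ms"]]) auto
qed auto

lemma wpt_mark_step:
  assumes p: "p < P" "sc s vI = p" and "marking C K p s"
  shows "wpt mark_step 200 (\<lambda>s'. marking C K (Suc p) s' \<and> sc s' vI = p \<and> sc s' vP = P) s"
proof -
  have st: "static s" "ar s aC = C" "ar s aCol = K" "sc s vK2 = 2 * k" "sc s vIt = 0"
    "ar s aFl = (\<lambda>_. 0)" "ar s aSat = (\<lambda>_. 0)"
    using assms(3) by (auto simp: marking_def)
  obtain Ms where Ms: "marks Ms s" "mark_inv C K p Ms (ar s aCT)"
    using assms(3) by (auto simp: marking_def)
  let ?new = "\<not> (C (eu p) \<in> Ms \<and> C (ev p) \<in> Ms)"
  have eqs: "ar s aEU = eu" "ar s aEV = ev" "ar s aES = es" "ar s aEL p = of_bool (pos p)"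
    "sc s vP = P" "ar s aM = (\<lambda>c. of_bool (c \<in> Ms))"
    using st(1) p Ms(1) by (auto simp: static_def marks_def)
  show ?thesis
  proof (cases "\<not> pos p \<and> C (eu p) \<noteq> C (ev p) \<and> ar s aCT (es p) < 2 * k \<and> ?new")
    case False
    then have "mark_inv C K (Suc p) Ms (ar s aCT)"
      using mark_inv_skip[OF Ms(2) p(1)] by (meson not_le)
    \<comment> \<open>Stated for every store that differs in temporary scalars only, so that it
      closes each branch of the program that marks nothing.\<close>
    then have "marking C K (Suc p) t" if "ar t = ar s" "outs t = outs s"
      "\<forall>x\<in>{vN, vP, vK, vK2, vIt, vMu}. sc t x = sc s x" for t
      using that st Ms(1) by (auto simp: marking_def marks_def static_def)
    note skip = this
    show ?thesis
      unfolding mark_step_def using False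
      by (cases "pos p"; cases "C (eu p) = C (ev p)"; cases "ar s aCT (es p) < 2 * k";
          cases "C (eu p) \<in> Ms"; cases "C (ev p) \<in> Ms")
        (simp_all add: exec_simps p eqs st(2-4) skip)
  next
    case True
    have inv: "mark_inv C K (Suc p) (insert (C (ev p)) (insert (C (eu p)) Ms))
      ((ar s aCT)(es p := Suc (ar s aCT (es p))))"
      using mark_inv_mark[OF Ms(2) p(1)] True by blast
    have mark: "wpt (mark_one vU ;; mark_one vV) T
        (\<lambda>s'. marking C K (Suc p) s' \<and> sc s' vI = p \<and> sc s' vP = P) t"
      if t: "\<forall>x\<in>{vN, vP, vK, vK2, vIt, vMu, vI}. sc t x = sc s x" "outs t = outs s"
        "sc t vU = C (eu p)" "sc t vV = C (ev p)"
        "ar t = (ar s)(aCT := (ar s aCT)(es p := Suc (ar s aCT (es p))))" "60 \<le> T" for t T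
    proof -
      have "marks Ms t" using Ms(1) t(1,5) by (simp add: marks_def)
      from wpt_mark_pair[OF this] show ?thesis
      proof (rule wpt_mono[OF _ t(6)], elim conjE, goal_cases)
        case (1 s')
        have "static s'" using st(1) 1 t(1,2,5) by (simp add: static_def)
        moreover have "ar s' aC = C" "ar s' aCol = K" "ar s' aFl = (\<lambda>_. 0)" "ar s' aSat = (\<lambda>_. 0)"
          "ar s' aCT = (ar s aCT)(es p := Suc (ar s aCT (es p)))"
          "sc s' vK2 = 2 * k" "sc s' vIt = 0" "sc s' vI = p" "sc s' vP = P"
          using 1 t(1,5) st p eqs by simp_all
        moreover have "marks (insert (C (ev p)) (insert (C (eu p)) Ms)) s'" using 1 t(3,4) by simp
        ultimately show ?case using inv unfolding marking_def by auto
      qed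
    qed
    show ?thesis
      unfolding mark_step_def using True
      by (cases "C (eu p) \<in> Ms"; cases "C (ev p) \<in> Ms")
        (simp_all add: exec_simps p eqs st(2-4) mark)
  qed
qed

lemma wpt_mark_code:
  assumes "merged P s" "ar s aC = C" "ar s aCol = K"
  shows "wpt mark_code (P * 206 + 6) (marking C K P) s"
proof -
  have "marking C K 0 (eff (Add vK2 vK vK) s)"
    using assms mark_inv_0[of C K]
    by (auto simp: marking_def merged_def static_def fresh_def marks_def bij_betw_def
        intro!: exI[of _ "{}"])
  then have "wpt (For vI vD vP mark_step) (P * 206 + 5) (marking C K P) (eff (Add vK2 vK vK) s)"
    by (intro wpt_mono[OF wpt_For[where I = "marking C K" and N = P and C = 200]] wpt_mark_step)
      (auto simp: marking_def static_def marks_def)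
  then show ?thesis
    unfolding mark_code_def wpt_Op_Seq by (simp add: add.commute)
qed

end

section \<open>Trying the flips of the marked components\<close>

definition color :: "nat \<Rightarrow> nat \<Rightarrow> com" where
  "color x y = Op (Get x aC y) ;; Op (Get x aFl x) ;; Op (Get vZ aCol y) ;; Op (Dist x x vZ)"

text \<open>Stamping a sample with the trial number replaces clearing \<open>aSat\<close> between
  trials. A sample is counted only when its stamp changes, so \<open>vCnt\<close> counts samples and
  not edges.\<close>

definition check_step :: com where
  "check_step = Op (Get vL aEL vI) ;;
     If vL Skip
       (Op (Get vU aEU vI) ;; color vA vU ;; Op (Get vV aEV vI) ;; color vB vV ;; Op (Dist vX vA vB) ;;
        If vX Skip
          (Op (Get vL aES vI) ;; Op (Get vY aSat vL) ;; Op (Dist vY vY vIt) ;;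
           If vY (Op (Put aSat vL vIt) ;; Op (AddC vCnt vCnt 1)) Skip))"

definition check_code :: com where
  "check_code = Op (AddC vIt vIt 1) ;; Op (Const vCnt 0) ;; For vI vD vP check_step"

text \<open>Binary increment with carry, the first listed component being the least significant
  digit.\<close>

definition next_step :: com where
  "next_step = If vCarry
     (Op (Get vX aML vI) ;; Op (Get vY aFl vX) ;;
      If vY (Op (Const vZ 0) ;; Op (Put aFl vX vZ))
        (Op (Const vZ 1) ;; Op (Put aFl vX vZ) ;; Op (Const vCarry 0)))
     Skip"

definition next_code :: com where
  "next_code = Op (Const vCarry 1) ;; For vI vD vMu next_step"

text \<open>A count of \<open>vK\<close> means that every negative sample is satisfied. A carry out
  of the last digit means that the counter has run through all flips.\<close>

definition search_step :: com where
  "search_step = check_code ;; Op (Dist vX vCnt vK) ;;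
     If vX (next_code ;; If vCarry (Op (Const vGo 0)) Skip)
       (Op (Const vGo 0) ;; Op (Const vFound 1))"

definition search_code :: com where
  "search_code = Op (Const vGo 1) ;; Op (Const vFound 0) ;; While vGo search_step"

definition print_step :: com where
  "print_step = Op (Get vU aVS vI) ;; color vA vU ;; If vA (Op (Print vU)) Skip"

definition print_code :: com where
  "print_code = Op (Const vX 1) ;; Op (Print vX) ;; For vI vD vN print_step"

locale search = edge_list +
  fixes C K :: "nat \<Rightarrow> nat" and Ms :: "nat set" and ml ct :: "nat \<Rightarrow> nat"
  assumes merge: "merge_inv P C K 0"
    and mark: "mark_inv C K P Ms ct"
    and ml: "bij_betw ml {..<card Ms} Ms"
begin

definition prepared :: "store \<Rightarrow> bool" where
  "prepared s \<longleftrightarrow> static s \<and> ar s aC = C \<and> ar s aCol = K \<and> ar s aML = ml \<and> sc s vMu = card Ms"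

definition constraint :: "nat \<Rightarrow> nat \<times> nat \<times> bool" where
  "constraint p = (C (eu p), C (ev p), K (eu p) = K (ev p))"

definition satisfied :: "(nat \<Rightarrow> bool) \<Rightarrow> nat \<Rightarrow> nat set" where
  "satisfied \<phi> p = {es q | q. q < p \<and> \<not> pos q \<and> agrees \<phi> (constraint q)}"

definition solution :: "(nat \<Rightarrow> bool) \<Rightarrow> bool" where
  "solution \<phi> \<longleftrightarrow> (\<forall>i\<in>Neg. \<exists>x\<in>constraints C K i. agrees \<phi> x)"

definition flips :: "(nat \<Rightarrow> nat) \<Rightarrow> bool" where
  "flips fl \<longleftrightarrow> (\<forall>c. fl c \<le> 1) \<and> {c. fl c \<noteq> 0} \<subseteq> Ms"

lemma satisfied_Suc:
  "satisfied \<phi> (Suc p) = (if \<not> pos p \<and> agrees \<phi> (constraint p) then insert (es p) (satisfied \<phi> p)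
     else satisfied \<phi> p)"
  by (auto simp: satisfied_def less_Suc_eq)

lemma satisfied_subset: "p \<le> P \<Longrightarrow> satisfied \<phi> p \<subseteq> Neg"
  using es_Neg by (auto simp: satisfied_def)

lemma finite_satisfied: "p \<le> P \<Longrightarrow> finite (satisfied \<phi> p)"
  using satisfied_subset finite_Neg finite_subset by blast

text \<open>Satisfied samples form a subset of the finite set \<open>Neg\<close> of size
  \<open>k\<close>, so counting them decides equality.\<close>

lemma solution_iff_card: "solution \<phi> \<longleftrightarrow> card (satisfied \<phi> P) = k"
proof -
  have "(\<exists>x\<in>constraints C K i. agrees \<phi> x) \<longleftrightarrow> i \<in> satisfied \<phi> P" if "i \<in> Neg" for i
  proof -
    have "(\<exists>x\<in>constraints C K i. agrees \<phi> x) \<longleftrightarrow> (\<exists>p<P. es p = i \<and> agrees \<phi> (constraint p))"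
      by (auto simp: constraints_def constraint_def)
    also have "\<dots> \<longleftrightarrow> i \<in> satisfied \<phi> P"
      using es_Neg that by (auto simp: satisfied_def)
    finally show ?thesis .
  qed
  then have "solution \<phi> \<longleftrightarrow> Neg \<subseteq> satisfied \<phi> P"
    by (auto simp: solution_def)
  also have "\<dots> \<longleftrightarrow> satisfied \<phi> P = Neg" using satisfied_subset[of P] by auto
  also have "\<dots> \<longleftrightarrow> card (satisfied \<phi> P) = k"
    unfolding k_def using card_subset_eq[OF finite_Neg satisfied_subset[of P]] by auto
  finally show ?thesis .
qed

lemma K_bit: "w \<in> V \<Longrightarrow> K w = 0 \<or> K w = 1"
  using merge by (auto simp: merge_inv_def le_Suc_eq)

lemma agrees_constraint:
  assumes "p < P" "\<And>c. fl c \<le> 1"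
  shows "agrees (\<lambda>c. fl c = 1) (constraint p) \<longleftrightarrow>
    gap (fl (C (eu p))) (K (eu p)) = gap (fl (C (ev p))) (K (ev p))"
proof -
  have "fl (C (eu p)) = 0 \<or> fl (C (eu p)) = 1" "fl (C (ev p)) = 0 \<or> fl (C (ev p)) = 1"
    using assms(2)[of "C (eu p)"] assms(2)[of "C (ev p)"] by auto
  then show ?thesis
    using K_bit[OF ends(1)[OF assms(1)]] K_bit[OF ends(2)[OF assms(1)]]
    by (elim disjE) (simp_all add: agrees_def constraint_def)
qed

text \<open>The bound of all stamps by \<open>it\<close> ensures that the next trial number has not
  occurred as a stamp.\<close>

definition check_inv :: "(nat \<Rightarrow> nat) \<Rightarrow> nat \<Rightarrow> nat \<Rightarrow> store \<Rightarrow> bool" where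
  "check_inv fl it p s \<longleftrightarrow> prepared s \<and> ar s aFl = fl \<and> sc s vIt = it \<and> sc s vGo = 1 \<and> sc s vFound = 0 \<and>
     sc s vCnt = card (satisfied (\<lambda>c. fl c = 1) p) \<and>
     (\<forall>i. ar s aSat i \<le> it \<and> (ar s aSat i = it \<longleftrightarrow> i \<in> satisfied (\<lambda>c. fl c = 1) p))"

lemma wpt_check_step:
  assumes p: "p < P" "sc s vI = p" and "check_inv fl it p s" and fl: "\<And>c. fl c \<le> 1"
  shows "wpt check_step 150 (\<lambda>s'. check_inv fl it (Suc p) s' \<and> sc s' vI = p \<and> sc s' vP = P) s"
proof -
  have eqs: "ar s aEU = eu" "ar s aEV = ev" "ar s aES = es" "ar s aEL p = of_bool (pos p)"
    "sc s vP = P" "ar s aC = C" "ar s aCol = K" "ar s aFl = fl" "sc s vIt = it"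
    using assms(3) p by (auto simp: check_inv_def prepared_def static_def)
  have fin: "finite (satisfied (\<lambda>c. fl c = 1) p)" using finite_satisfied p by simp
  let ?sat = "\<not> pos p \<and> gap (fl (C (eu p))) (K (eu p)) = gap (fl (C (ev p))) (K (ev p))"
  have Suc: "satisfied (\<lambda>c. fl c = 1) (Suc p) = (if ?sat then insert (es p) (satisfied (\<lambda>c. fl c = 1) p)
     else satisfied (\<lambda>c. fl c = 1) p)"
    using agrees_constraint[of p fl] p fl by (auto simp: satisfied_Suc)
  have skip: "check_inv fl it (Suc p) t"
    if "\<not> ?sat \<or> ar s aSat (es p) = it" "ar t = ar s" "outs t = outs s"
      "\<forall>x\<in>{vN, vP, vK, vMu, vIt, vGo, vFound, vCnt}. sc t x = sc s x" for t
  proof -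
    have "satisfied (\<lambda>c. fl c = 1) (Suc p) = satisfied (\<lambda>c. fl c = 1) p"
      using that(1) assms(3) unfolding Suc by (auto simp: check_inv_def)
    then show ?thesis using that(2-) assms(3) by (simp add: check_inv_def prepared_def static_def)
  qed
  have new: "check_inv fl it (Suc p) t"
    if "?sat" "ar s aSat (es p) \<noteq> it" "ar t = (ar s)(aSat := (ar s aSat)(es p := it))" "outs t = outs s"
      "\<forall>x\<in>{vN, vP, vK, vMu, vIt, vGo, vFound}. sc t x = sc s x" "sc t vCnt = Suc (sc s vCnt)" for t
  proof -
    have "satisfied (\<lambda>c. fl c = 1) (Suc p) = insert (es p) (satisfied (\<lambda>c. fl c = 1) p)"
      using that(1) unfolding Suc by simp
    moreover have "es p \<notin> satisfied (\<lambda>c. fl c = 1) p" using that(2) assms(3) by (auto simp: check_inv_def)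
    ultimately show ?thesis
      using that(3-) assms(3) fin by (simp add: check_inv_def prepared_def static_def)
  qed
  show ?thesis
    unfolding check_step_def color_def
    by (cases "pos p"; cases "gap (fl (C (eu p))) (K (eu p)) = gap (fl (C (ev p))) (K (ev p))";
        cases "ar s aSat (es p) = it")
      (simp_all add: exec_simps p eqs skip new)
qed

lemma wpt_check_code:
  assumes "prepared s" "ar s aFl = fl" "\<And>c. fl c \<le> 1" "\<forall>i. ar s aSat i \<le> sc s vIt"
    "sc s vGo = 1" "sc s vFound = 0"
  shows "wpt check_code (P * 156 + 8) (check_inv fl (Suc (sc s vIt)) P) s"
proof -
  let ?s = "eff (Const vCnt 0) (eff (AddC vIt vIt 1) s)"
  have "satisfied (\<lambda>c. fl c = 1) 0 = {}" by (simp add: satisfied_def)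
  then have "check_inv fl (Suc (sc s vIt)) 0 ?s"
    \<comment> \<open>The trial number is raised before the scan, so old stamps, including the
      initial 0, are strictly smaller than the current one.\<close>
    using assms by (auto simp: check_inv_def prepared_def static_def le_Suc_eq) (metis Suc_n_not_le_n)
  then have "wpt (For vI vD vP check_step) (P * 156 + 5) (check_inv fl (Suc (sc s vIt)) P) ?s"
    by (intro wpt_mono[OF wpt_For[where I = "check_inv fl (Suc (sc s vIt))" and N = P and C = 150]]
         wpt_check_step[OF _ _ _ assms(3)])
      (auto simp: check_inv_def prepared_def static_def)
  then show ?thesis
    unfolding check_code_def wpt_Op_Seq by (simp add: add.commute)
qed

text \<open>The equation is the usual one for adding 1: the low \<open>i\<close> digits together
  with the carry represent the old low digits plus 1, and higher digits are untouched.\<close>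

definition next_inv :: "(nat \<Rightarrow> nat) \<Rightarrow> nat \<Rightarrow> nat \<Rightarrow> store \<Rightarrow> bool" where
  "next_inv fl it i s \<longleftrightarrow> prepared s \<and> flips (ar s aFl) \<and> sc s vCarry \<le> 1 \<and>
     binary_value i (ar s aFl \<circ> ml) + sc s vCarry * 2 ^ i = binary_value i (fl \<circ> ml) + 1 \<and>
     (\<forall>j. i \<le> j \<longrightarrow> j < card Ms \<longrightarrow> ar s aFl (ml j) = fl (ml j)) \<and>
     (\<forall>i. ar s aSat i \<le> it) \<and> sc s vIt = it \<and> sc s vGo = 1 \<and> sc s vFound = 0"

lemma ml_eq_iff: "i < card Ms \<Longrightarrow> j < card Ms \<Longrightarrow> ml i = ml j \<longleftrightarrow> i = j"
  using ml by (auto simp: bij_betw_def inj_on_def)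

lemma ml_in: "i < card Ms \<Longrightarrow> ml i \<in> Ms"
  using ml by (auto simp: bij_betw_def)

lemma wpt_next_step:
  assumes i: "i < card Ms" "sc s vI = i" and inv: "next_inv fl it i s"
  shows "wpt next_step 40
    (\<lambda>s'. next_inv fl it (Suc i) s' \<and> sc s' vI = i \<and> sc s' vMu = card Ms) s"
proof -
  have eqs: "ar s aML = ml" "sc s vMu = card Ms"
    using inv by (auto simp: next_inv_def prepared_def)
  let ?f = "ar s aFl"
  \<comment> \<open>Position \<open>i\<close> is not among the lower positions and \<open>ml\<close>
    is injective, so changing this digit leaves the lower value alone.\<close>
  have bv: "binary_value i (?f(ml i := a) \<circ> ml) = binary_value i (?f \<circ> ml)" for a
    unfolding binary_value_def using ml_eq_iff i(1) by (intro sum.cong) auto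
  have same: "?f (ml i) = fl (ml i)" using inv i by (auto simp: next_inv_def)
  have bit: "?f (ml i) = 0 \<or> ?f (ml i) = 1"
    using inv by (auto simp: next_inv_def flips_def le_Suc_eq)
  have carry: "sc s vCarry = 0 \<or> sc s vCarry = 1"
    using inv by (auto simp: next_inv_def le_Suc_eq)
  have skip: "next_inv fl it (Suc i) t"
    if "sc s vCarry = 0" "ar t = ar s" "outs t = outs s"
      "\<forall>x\<in>{vN, vP, vK, vMu, vIt, vGo, vFound, vCarry}. sc t x = sc s x" for t
    using inv that same by (auto simp: next_inv_def prepared_def static_def binary_value_Suc)
  have upd: "next_inv fl it (Suc i) t"
    if c: "sc s vCarry > 0" and b: "b = 1 - ?f (ml i)"
      and t: "ar t = (ar s)(aFl := ?f(ml i := b))" "outs t = outs s"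
      "\<forall>x\<in>{vN, vP, vK, vMu, vIt, vGo, vFound}. sc t x = sc s x" "sc t vCarry = ?f (ml i)" for t b
  proof -
    have "sc s vCarry = 1" using c inv by (auto simp: next_inv_def)
    moreover have "flips (?f(ml i := b))"
      using inv ml_in[OF i(1)] b by (auto simp: next_inv_def flips_def)
    moreover have "(?f(ml i := b)) (ml j) = fl (ml j)" if "Suc i \<le> j" "j < card Ms" for j
      using inv ml_eq_iff[OF i(1) that(2)] that by (auto simp: next_inv_def)
    moreover have "binary_value (Suc i) (?f(ml i := b) \<circ> ml) + ?f (ml i) * 2 ^ Suc i =
        binary_value (Suc i) (fl \<circ> ml) + 1"
      using inv bit calculation(1) b same[symmetric] by (auto simp: next_inv_def binary_value_Suc bv)
    ultimately show ?thesis
      using inv t bit by (auto simp: next_inv_def prepared_def static_def)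
  qed
  show ?thesis
    unfolding next_step_def
    by (cases "sc s vCarry = 0"; cases "?f (ml i) = 0")
      (use bit carry in \<open>simp_all add: exec_simps i eqs skip upd\<close>)
qed

lemma wpt_next_code:
  assumes "prepared s" "ar s aFl = fl" "flips fl" "\<forall>i. ar s aSat i \<le> sc s vIt"
    "sc s vGo = 1" "sc s vFound = 0"
  shows "wpt next_code (card Ms * 46 + 6) (next_inv fl (sc s vIt) (card Ms)) s"
proof -
  have "next_inv fl (sc s vIt) 0 (eff (Const vCarry 1) s)"
    using assms by (auto simp: next_inv_def prepared_def static_def binary_value_def)
  then have "wpt (For vI vD vMu next_step) (card Ms * 46 + 5) (next_inv fl (sc s vIt) (card Ms))
      (eff (Const vCarry 1) s)"
    by (intro wpt_mono[OF wpt_For[where I = "next_inv fl (sc s vIt)" and N = "card Ms" and C = 40]]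
         wpt_next_step)
      (auto simp: next_inv_def prepared_def static_def)
  then show ?thesis
    unfolding next_code_def wpt_Op_Seq by (simp add: add.commute)
qed


text \<open>The flips are tried in the order of their binary values, so \<open>i\<close> counts the trials.\<close>

definition search_inv :: "nat \<Rightarrow> store \<Rightarrow> bool" where
  "search_inv i s \<longleftrightarrow> prepared s \<and> flips (ar s aFl) \<and> (\<forall>i. ar s aSat i \<le> sc s vIt) \<and>
     (if sc s vGo > 0
      then sc s vGo = 1 \<and> sc s vFound = 0 \<and> binary_value (card Ms) (ar s aFl \<circ> ml) = i \<and>
        (\<forall>fl. flips fl \<longrightarrow> binary_value (card Ms) (fl \<circ> ml) < i \<longrightarrow> \<not> solution (\<lambda>c. fl c = 1))
      else if sc s vFound > 0 then solution (\<lambda>c. ar s aFl c = 1)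
      else (\<forall>fl. flips fl \<longrightarrow> \<not> solution (\<lambda>c. fl c = 1)))"

text \<open>Hence the assignment just tested is the only one with its value, and a failed trial
  settles that value for good.\<close>

lemma flips_eqI:
  assumes "flips fl" "flips fl'" "binary_value (card Ms) (fl \<circ> ml) = binary_value (card Ms) (fl' \<circ> ml)"
  shows "fl = fl'"
proof
  fix c
  show "fl c = fl' c"
  proof (cases "c \<in> Ms")
    case True
    then obtain i where "i < card Ms" "c = ml i" using ml by (auto simp: bij_betw_def)
    then show ?thesis
      using binary_value_inj[of "card Ms" "fl \<circ> ml" "fl' \<circ> ml" i] assms by (simp add: flips_def)
  next
    case False
    then have "fl c = 0" "fl' c = 0" using assms(1,2) unfolding flips_def by blast+
    then show ?thesis by simp
  qed
qed

lemma flips_value_less: "flips fl \<Longrightarrow> binary_value (card Ms) (fl \<circ> ml) < 2 ^ card Ms"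
  by (intro binary_value_less) (simp add: flips_def)

text \<open>The pass number equals the counter value, which has \<open>card Ms\<close> binary
  digits; this bounds the number of passes.\<close>

lemma wpt_search_step:
  assumes inv: "search_inv i s" and go: "sc s vGo > 0"
  shows "i < 2 ^ card Ms \<and> wpt search_step (P * 156 + card Ms * 46 + 30) (search_inv (Suc i)) s"
proof
  define fl where "fl = ar s aFl"
  have s: "prepared s" "flips fl" "\<forall>i. ar s aSat i \<le> sc s vIt" "sc s vGo = 1" "sc s vFound = 0"
    and val: "binary_value (card Ms) (fl \<circ> ml) = i"
    and tried: "\<And>fl. flips fl \<Longrightarrow> binary_value (card Ms) (fl \<circ> ml) < i \<Longrightarrow> \<not> solution (\<lambda>c. fl c = 1)"
    using inv go unfolding search_inv_def fl_def by auto
  show "i < 2 ^ card Ms" using flips_value_less[OF s(2)] val by simp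
  have check: "wpt check_code (P * 156 + 8) (check_inv fl (Suc (sc s vIt)) P) s"
    using s by (intro wpt_check_code) (auto simp: fl_def flips_def)
  show "wpt search_step (P * 156 + card Ms * 46 + 30) (search_inv (Suc i)) s"
    unfolding search_step_def
  proof (rule wpt_Seq[where ?T2.0 = "card Ms * 46 + 22", OF wpt_mono[OF check order_refl]])
    fix t assume t: "check_inv fl (Suc (sc s vIt)) P t"
    have K: "sc t vK = k" and cnt: "sc t vCnt = k \<longleftrightarrow> solution (\<lambda>c. fl c = 1)"
      using t by (auto simp: check_inv_def prepared_def static_def solution_iff_card)
    show "wpt (Op (Dist vX vCnt vK) ;;
       If vX (next_code ;; If vCarry (Op (Const vGo 0)) Skip)
         (Op (Const vGo 0) ;; Op (Const vFound 1))) (card Ms * 46 + 22) (search_inv (Suc i)) t"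
    proof (cases "sc t vCnt = k")
      case True
      then show ?thesis
        using t K cnt s(2)
        by (simp add: exec_simps search_inv_def check_inv_def prepared_def static_def)
    next
      case False
      let ?t = "eff (Dist vX vCnt vK) t"
      have "wpt next_code (card Ms * 46 + 6) (next_inv fl (sc ?t vIt) (card Ms)) ?t"
        using t s(2) by (intro wpt_next_code) (auto simp: check_inv_def prepared_def static_def)
      then have "wpt (next_code ;; If vCarry (Op (Const vGo 0)) Skip) (card Ms * 46 + 16)
          (search_inv (Suc i)) ?t"
      proof (rule wpt_Seq[where ?T2.0 = 10, OF wpt_mono[OF _ order_refl]])
        fix u assume u: "next_inv fl (sc ?t vIt) (card Ms) u"
        have tried': "\<not> solution (\<lambda>c. fl' c = 1)"
          if "flips fl'" "binary_value (card Ms) (fl' \<circ> ml) < Suc i" for fl'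
        proof (cases "binary_value (card Ms) (fl' \<circ> ml) = i")
          case True
          then have "fl' = fl" using flips_eqI that(1) s(2) val by simp
          then show ?thesis using False cnt by simp
        qed (use tried that in auto)
        have u': "prepared u" "flips (ar u aFl)" "\<forall>i. ar u aSat i \<le> sc u vIt"
          "sc u vGo = 1" "sc u vFound = 0" "sc u vCarry = 0 \<or> sc u vCarry = 1"
          "binary_value (card Ms) (ar u aFl \<circ> ml) + sc u vCarry * 2 ^ card Ms = Suc i"
          using u val by (auto simp: next_inv_def le_Suc_eq)
        show "wpt (If vCarry (Op (Const vGo 0)) Skip) 10 (search_inv (Suc i)) u"
        proof (cases "sc u vCarry = 0")
          case True
          then show ?thesis
            using u' tried' by (simp add: exec_simps search_inv_def prepared_def static_def)
        next
          case False
          \<comment> \<open>A remaining carry contributes \<open>2 ^ card Ms\<close>, so the values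
            below \<open>Suc i\<close>, all tried by now, are all values there are.\<close>
          then have "2 ^ card Ms \<le> Suc i" using u'(6,7) by auto
          then have "\<not> solution (\<lambda>c. fl' c = 1)" if "flips fl'" for fl'
            using tried'[OF that] flips_value_less[OF that] by simp
          then show ?thesis
            using False u' by (simp add: exec_simps search_inv_def prepared_def static_def)
        qed
      qed simp
      then have "wpt (next_code ;; If vCarry (Op (Const vGo 0)) Skip) (card Ms * 46 + 18)
          (search_inv (Suc i)) ?t"
        by (rule wpt_mono) auto
      then show ?thesis
        using False K unfolding wpt_Op_Seq wpt_If_iff by (simp add: add.commute)
    qed
  qed simp
qed

lemma wpt_search_code:
  assumes "prepared s" "ar s aFl = (\<lambda>_. 0)" "ar s aSat = (\<lambda>_. 0)"
  shows "wpt search_code (2 ^ card Ms * (P * 156 + card Ms * 46 + 33) + 5)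
    (\<lambda>s'. sc s' vGo = 0 \<and> (\<exists>i. search_inv i s')) s"
proof -
  let ?s = "eff (Const vFound 0) (eff (Const vGo 1) s)"
  have "search_inv 0 ?s"
    using assms by (simp add: search_inv_def prepared_def static_def flips_def binary_value_def)
  then have "wpt (While vGo search_step) (2 ^ card Ms * (P * 156 + card Ms * 46 + 30 + 3) + 3)
    (\<lambda>s'. sc s' vGo = 0 \<and> (\<exists>i. search_inv i s')) ?s"
    by (intro wpt_While wpt_search_step)
  then show ?thesis
    unfolding search_code_def wpt_Op_Seq by (simp add: add.commute add.left_commute)
qed

text \<open>Completeness of the restricted search: a consistent set yields some flips, and the
  exchange argument moves them onto the marked components.\<close>

lemma no_solution:
  assumes "\<forall>fl. flips fl \<longrightarrow> \<not> solution (\<lambda>c. fl c = 1)"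
  shows "\<not> consistent (V, S) X"
proof
  assume "consistent (V, S) X"
  then obtain \<phi> where "\<forall>i\<in>Neg. \<exists>x\<in>constraints C K i. agrees \<phi> x"
    using consistent_imp_agrees(2)[OF merge] by blast
  from mark_inv_solution[OF mark this] obtain \<psi> where \<psi>: "{c. \<psi> c} \<subseteq> Ms" "solution \<psi>"
    unfolding solution_def by blast
  have "flips (\<lambda>c. of_bool (\<psi> c))" using \<psi>(1) by (auto simp: flips_def)
  moreover have "(\<lambda>c. of_bool (\<psi> c) = (1 :: nat)) = \<psi>" by auto
  ultimately show False using assms \<psi>(2) by metis
qed

lemma wpt_print_code:
  assumes "prepared s" "flips (ar s aFl)" "solution (\<lambda>c. ar s aFl c = 1)"
  shows "wpt print_code (length vs * 56 + 7) (\<lambda>s'. conscheck_answer (V, S) (outs s')) s"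
proof -
  define fl where "fl = ar s aFl"
  let ?X = "colored C K (\<lambda>c. fl c = 1)" and ?s = "eff (Print vX) (eff (Const vX 1) s)"
  let ?I = "\<lambda>j s'. ar s' = ar s \<and> outs s' = 1 # filter (\<lambda>w. w \<in> ?X) (take j vs)"
  have st: "ar s aC = C" "ar s aCol = K" "\<And>i. i < length vs \<Longrightarrow> ar s aVS i = vs ! i"
    "outs s = []" "sc s vN = length vs"
    using assms(1) by (auto simp: prepared_def static_def)
  have X: "w \<in> ?X \<longleftrightarrow> gap (fl (C w)) (K w) > 0" if "w \<in> V" for w
  proof -
    have "fl (C w) = 0 \<or> fl (C w) = 1" using assms(2) by (auto simp: flips_def fl_def le_Suc_eq)
    then show ?thesis using K_bit[OF that] that by (auto simp: colored_def)
  qed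
  have "wpt (For vI vD vN print_step) (length vs * 56 + 5) (\<lambda>s'. ?I (length vs) s' \<and> sc s' vN = length vs) ?s"
  proof (rule wpt_For[where I = ?I and C = 50])
    fix j and t :: store assume t: "j < length vs" "?I j t" "sc t vI = j" "sc t vN = length vs"
    have V: "vs ! j \<in> V" using t(1) distinct_vs(2) nth_mem by blast
    show "wpt print_step 50 (\<lambda>s'. ?I (Suc j) s' \<and> sc s' vI = j \<and> sc s' vN = length vs) t"
      unfolding print_step_def color_def using t X[OF V] V
      by (cases "vs ! j \<in> ?X") (simp_all add: exec_simps st fl_def take_Suc_conv_app_nth)
  qed (auto simp: st)
  then have "wpt print_code (length vs * 56 + 7)
      (\<lambda>s'. ?I (length vs) s' \<and> sc s' vN = length vs) s"
    unfolding print_code_def wpt_Op_Seq by (simp add: add.commute)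
  then show ?thesis
  proof (rule wpt_mono)
    fix t assume "?I (length vs) t \<and> sc t vN = length vs"
    then have "outs t = 1 # filter (\<lambda>w. w \<in> ?X) vs" by simp
    moreover have "consistent (V, S) ?X"
      using consistent_colored[OF merge] assms(3) by (simp add: solution_def fl_def)
    moreover have "lists_set (filter (\<lambda>w. w \<in> ?X) vs) ?X"
      using distinct_vs by (auto simp: lists_set_def colored_def)
    ultimately show "conscheck_answer (V, S) (outs t)"
      unfolding conscheck_answer_def by blast
  qed simp
qed

end

section \<open>Assembling the solver\<close>

definition fail_code :: com where
  "fail_code = Op (Const vX 0) ;; Op (Print vX)"

definition solve_code :: com where
  "solve_code = merge_code ;;
     If vF fail_code (mark_code ;; search_code ;; If vFound print_code fail_code)"

context edge_list
begin

lemma wpt_fail_code: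
  assumes "static s" "\<And>X. \<not> consistent (V, S) X"
  shows "wpt fail_code 2 (\<lambda>s'. conscheck_answer (V, S) (outs s')) s"
  using assms by (simp add: fail_code_def exec_simps static_def conscheck_answer_def)

lemma wpt_solve_code:
  assumes "merged 0 s"
  shows "wpt solve_code
    (P * (length vs * 55 + 90) + P * 206 + 16 ^ (k * k) * (P * 248 + 33) + length vs * 56 + 40)
    (\<lambda>s'. conscheck_answer (V, S) (outs s')) s"
  unfolding solve_code_def
proof (rule wpt_Seq[OF wpt_mono[OF wpt_merge_code[OF assms] order_refl]])
  fix s assume s: "merged P s"
  let ?T = "P * 206 + 16 ^ (k * k) * (P * 248 + 33) + length vs * 56 + 35"
  show "wpt (If vF fail_code (mark_code ;; search_code ;; If vFound print_code fail_code)) ?T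
      (\<lambda>s'. conscheck_answer (V, S) (outs s')) s"
  proof (rule wpt_If)
    assume "sc s vF > 0"
    then have "\<not> consistent (V, S) X" for X
      using s consistent_imp_agrees(1)[of "ar s aC" "ar s aCol" "sc s vF" X] by (auto simp: merged_def)
    then have "wpt fail_code 2 (\<lambda>s'. conscheck_answer (V, S) (outs s')) s"
      using wpt_fail_code s by (auto simp: merged_def)
    then show "1 \<le> ?T \<and> wpt fail_code (?T - 1) (\<lambda>s'. conscheck_answer (V, S) (outs s')) s"
      by (auto elim: wpt_mono)
  next
    assume F: "sc s vF = 0"
    define C K where "C = ar s aC" and "K = ar s aCol"
    have merge: "merge_inv P C K 0" using s F by (auto simp: merged_def C_def K_def)
    have "wpt (mark_code ;; search_code ;; If vFound print_code fail_code) (?T - 3)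
        (\<lambda>s'. conscheck_answer (V, S) (outs s')) s"
    proof (rule wpt_Seq[OF wpt_mono[OF wpt_mark_code[OF s C_def[symmetric] K_def[symmetric]] order_refl]])
      fix s assume s: "marking C K P s"
      then obtain Ms where Ms: "marks Ms s" "mark_inv C K P Ms (ar s aCT)"
        by (auto simp: marking_def)
      have mu: "sc s vMu = card Ms"
        using Ms(1) bij_betw_same_card[of "ar s aML" "{..<sc s vMu}" Ms] by (simp add: marks_def)
      interpret search V S vs P eu ev es C K Ms "ar s aML" "ar s aCT"
        using merge Ms mu by unfold_locales (auto simp: marks_def)
      have s': "prepared s" "ar s aFl = (\<lambda>_. 0)" "ar s aSat = (\<lambda>_. 0)"
        using s mu by (auto simp: marking_def prepared_def)
      have card: "card Ms \<le> 4 * (k * k)" "card Ms \<le> 2 * P"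
        using mark_inv_card[OF Ms(2)] Ms(2) by (auto simp: mark_inv_def)
      \<comment> \<open>Here the base 16 arises, as \<open>2 ^ 4\<close>.\<close>
      have "(2 :: nat) ^ card Ms \<le> 2 ^ (4 * (k * k))" using card(1) by (simp add: power_increasing)
      also have "\<dots> = 16 ^ (k * k)" by (simp only: power_mult) simp
      \<comment> \<open>With \<open>card Ms \<le> 2 * P\<close> the cost of incrementing the counter
        is at most \<open>92 * P\<close>, and \<open>156 + 92 = 248\<close>.\<close>
      finally have "2 ^ card Ms * (P * 156 + card Ms * 46 + 33) \<le> 16 ^ (k * k) * (P * 248 + 33)"
        using card(2) by (intro mult_le_mono) auto
      then have T: "2 ^ card Ms * (P * 156 + card Ms * 46 + 33) + 5 + (length vs * 56 + 10)
          \<le> 16 ^ (k * k) * (P * 248 + 33) + length vs * 56 + 15" by simp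
      show "wpt (search_code ;; If vFound print_code fail_code)
          (16 ^ (k * k) * (P * 248 + 33) + length vs * 56 + 15)
          (\<lambda>s'. conscheck_answer (V, S) (outs s')) s"
      proof (rule wpt_Seq[OF wpt_mono[OF wpt_search_code[OF s'] order_refl] T])
        fix t assume "sc t vGo = 0 \<and> (\<exists>i. search_inv i t)"
        then have t: "prepared t" "flips (ar t aFl)"
          "if sc t vFound > 0 then solution (\<lambda>c. ar t aFl c = 1)
           else (\<forall>fl. flips fl \<longrightarrow> \<not> solution (\<lambda>c. fl c = 1))"
          by (auto simp: search_inv_def)
        show "wpt (If vFound print_code fail_code) (length vs * 56 + 10)
          (\<lambda>s'. conscheck_answer (V, S) (outs s')) t"
        proof (rule wpt_If)
          assume "sc t vFound > 0"
          then show "1 \<le> length vs * 56 + 10 \<and> wpt print_code (length vs * 56 + 10 - 1)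
            (\<lambda>s'. conscheck_answer (V, S) (outs s')) t"
            using wpt_mono[OF wpt_print_code[OF t(1,2)]] t(3) by auto
        next
          assume "sc t vFound = 0"
          then have "wpt fail_code 2 (\<lambda>s'. conscheck_answer (V, S) (outs s')) t"
            using t no_solution by (intro wpt_fail_code) (auto simp: prepared_def)
          then show "3 \<le> length vs * 56 + 10 \<and> wpt fail_code (length vs * 56 + 10 - 3)
            (\<lambda>s'. conscheck_answer (V, S) (outs s')) t"
            by (auto elim: wpt_mono)
        qed
      qed
    qed simp
    then show "3 \<le> ?T \<and> wpt (mark_code ;; search_code ;; If vFound print_code fail_code) (?T - 3)
        (\<lambda>s'. conscheck_answer (V, S) (outs s')) s" by simp
  qed
qed simp

end

section \<open>Reading the input\<close>

definition read_vertices :: com where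
  "read_vertices = Op (Read vN) ;; For vI vD vN
     (Op (Read vX) ;; Op (Put aVS vI vX) ;; Op (Put aC vX vX))"

definition read_edge :: com where
  "read_edge = Op (Read vU) ;; Op (Read vV) ;; Op (Put aEU vP vU) ;; Op (Put aEV vP vV) ;;
     Op (Put aES vP vI) ;; Op (Put aEL vP vL) ;; Op (AddC vP vP 1)"

definition read_sample :: com where
  "read_sample = Op (Read vL) ;; Op (Read vM) ;; If vL Skip (Op (AddC vK vK 1)) ;;
     For vJ vE vM read_edge"

definition read_samples :: com where
  "read_samples = Op (Read vT) ;; For vI vD vT read_sample"

definition conscheck_code :: com where
  "conscheck_code = read_vertices ;; read_samples ;; solve_code"

lemma length_concat_pairs: "length (concat (map (\<lambda>(u, v). [u, v]) es)) = 2 * length es"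
  by (induction es) auto

locale encoded_instance =
  fixes V :: "nat set" and S :: "(nat set set \<times> bool) list" and vs :: "nat list"
    and ws :: "nat list list"
  assumes instance_VS: "conscheck_instance (V, S)"
    and vs: "lists_set vs V"
    and ws: "list_all2 encodes_sample S ws"
begin

text \<open>Collects what merging expects at its start, in particular singleton components and
  relative colors 0.\<close>

definition header :: "store \<Rightarrow> bool" where
  "header s \<longleftrightarrow> sc s vN = length vs \<and> (\<forall>i<length vs. ar s aVS i = vs ! i) \<and>
     ar s aC = (\<lambda>w. if w \<in> V then w else 0) \<and>
     (\<forall>j\<in>{aCol, aM, aCT, aFl, aSat}. ar s j = (\<lambda>_. 0)) \<and>
     (\<forall>x\<in>{vF, vMu, vIt}. sc s x = 0) \<and> outs s = []"

lemma wpt_read_vertices: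
  "wpt read_vertices (length vs * 26 + 6)
    (\<lambda>s. header s \<and> sc s vK = 0 \<and> sc s vP = 0 \<and> ins s = rest)
    (initial_store (length vs # vs @ rest))"
proof -
  let ?I = "\<lambda>j s. ins s = drop j vs @ rest \<and> (\<forall>i<j. ar s aVS i = vs ! i) \<and>
     ar s aC = (\<lambda>w. if w \<in> set (take j vs) then w else 0) \<and>
     (\<forall>j\<in>{aCol, aM, aCT, aFl, aSat}. ar s j = (\<lambda>_. 0)) \<and>
     (\<forall>x\<in>{vF, vMu, vIt, vK, vP}. sc s x = 0) \<and> outs s = []"
  let ?s = "eff (Read vN) (initial_store (length vs # vs @ rest))"
  have "wpt (For vI vD vN (Op (Read vX) ;; Op (Put aVS vI vX) ;; Op (Put aC vX vX)))
     (length vs * 26 + 5) (\<lambda>s. ?I (length vs) s \<and> sc s vN = length vs) ?s"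
  proof (rule wpt_For[where C = 20])
    fix j and s :: store assume s: "j < length vs" "?I j s" "sc s vI = j" "sc s vN = length vs"
    then have "ins s = vs ! j # (drop (Suc j) vs @ rest)" by (simp add: Cons_nth_drop_Suc)
    then show "wpt (Op (Read vX) ;; Op (Put aVS vI vX) ;; Op (Put aC vX vX)) 20
      (\<lambda>s'. ?I (Suc j) s' \<and> sc s' vI = j \<and> sc s' vN = length vs) s"
      using s by (simp add: exec_simps take_Suc_conv_app_nth fun_eq_iff less_Suc_eq)
  qed (auto simp: initial_store_def)
  then have "wpt read_vertices (length vs * 26 + 6) (\<lambda>s. ?I (length vs) s \<and> sc s vN = length vs)
      (initial_store (length vs # vs @ rest))"
    unfolding read_vertices_def wpt_Op_Seq by (simp add: add.commute)
  then show ?thesis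
    by (rule wpt_mono) (use vs in \<open>auto simp: header_def lists_set_def\<close>)
qed

definition edges_ok :: "nat \<Rightarrow> store \<Rightarrow> bool" where
  "edges_ok b s \<longleftrightarrow> (\<forall>q<sc s vP. ar s aES q < b \<and>
     {ar s aEU q, ar s aEV q} \<in> fst (S ! ar s aES q) \<and> ar s aEL q = of_bool (snd (S ! ar s aES q)))"

definition covers :: "nat \<Rightarrow> nat set set \<Rightarrow> store \<Rightarrow> bool" where
  "covers i A s \<longleftrightarrow> (\<forall>e\<in>A. \<exists>q<sc s vP. ar s aES q = i \<and> e = {ar s aEU q, ar s aEV q})"

definition negatives :: "nat \<Rightarrow> nat" where
  "negatives i = card {j. j < i \<and> \<not> snd (S ! j)}"

definition samples_inv :: "nat \<Rightarrow> store \<Rightarrow> bool" where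
  "samples_inv i s \<longleftrightarrow> header s \<and> sc s vK = negatives i \<and> ins s = concat (drop i ws) \<and>
     edges_ok i s \<and> (\<forall>j<i. covers j (fst (S ! j)) s) \<and> sc s vP \<le> length (concat (take i ws))"

text \<open>The bound on \<open>vP\<close> charges each edge to the input, which later makes the
  number of edges at most the word length.\<close>

definition edges_inv :: "nat \<Rightarrow> (nat \<times> nat) list \<Rightarrow> nat \<Rightarrow> store \<Rightarrow> bool" where
  "edges_inv i es j s \<longleftrightarrow> header s \<and> sc s vK = negatives (Suc i) \<and>
     ins s = concat (map (\<lambda>(u, v). [u, v]) (drop j es)) @ concat (drop (Suc i) ws) \<and>
     edges_ok (Suc i) s \<and> (\<forall>j<i. covers j (fst (S ! j)) s) \<and>
     covers i ((\<lambda>(u, v). {u, v}) ` set (take j es)) s \<and>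
     sc s vP \<le> length (concat (take i ws)) + j \<and>
     sc s vL = of_bool (snd (S ! i)) \<and> sc s vI = i \<and> sc s vT = length S"

lemma negatives_Suc: "negatives (Suc i) = negatives i + of_bool (\<not> snd (S ! i))"
proof -
  have "{j. j < Suc i \<and> \<not> snd (S ! j)} =
      (if snd (S ! i) then {j. j < i \<and> \<not> snd (S ! j)} else insert i {j. j < i \<and> \<not> snd (S ! j)})"
    by (auto simp: less_Suc_eq)
  then show ?thesis by (simp add: negatives_def)
qed

lemma wpt_read_edge:
  assumes j: "j < length es" "sc s vJ = j" "sc s vM = length es"
    and inv: "edges_inv i es j s" and es: "(\<lambda>(u, v). {u, v}) ` set es = fst (S ! i)"
  shows "wpt read_edge 40
    (\<lambda>s'. edges_inv i es (Suc j) s' \<and> sc s' vJ = j \<and> sc s' vM = length es) s"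
proof -
  obtain u v where uv: "es ! j = (u, v)" by fastforce
  have ins: "ins s = u # v # concat (map (\<lambda>(u, v). [u, v]) (drop (Suc j) es)) @ concat (drop (Suc i) ws)"
    using inv uv Cons_nth_drop_Suc[OF j(1), symmetric] by (simp add: edges_inv_def)
  have e: "{u, v} \<in> fst (S ! i)" using es uv nth_mem[OF j(1)] by force
  let ?p = "sc s vP"
  have "edges_inv i es (Suc j) t"
    if t: "ins t = concat (map (\<lambda>(u, v). [u, v]) (drop (Suc j) es)) @ concat (drop (Suc i) ws)"
      "outs t = outs s" "sc t vP = Suc ?p"
      "\<forall>x\<in>{vN, vF, vMu, vIt, vK, vL, vI, vT}. sc t x = sc s x"
      "ar t aEU = (ar s aEU)(?p := u)" "ar t aEV = (ar s aEV)(?p := v)"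
      "ar t aES = (ar s aES)(?p := i)" "ar t aEL = (ar s aEL)(?p := sc s vL)"
      "\<forall>j\<in>{aVS, aC, aCol, aM, aCT, aFl, aSat}. ar t j = ar s j" for t
  proof -
    have "header t" using inv t by (simp add: edges_inv_def header_def)
    moreover have "edges_ok (Suc i) t"
      using inv t e by (auto simp: edges_inv_def edges_ok_def less_Suc_eq)
    moreover have covers: "covers l A t" if old: "covers l A s" for l A
      unfolding covers_def
    proof
      fix e assume "e \<in> A"
      then obtain q where "q < ?p" "ar s aES q = l" "e = {ar s aEU q, ar s aEV q}"
        using old unfolding covers_def by blast
      then show "\<exists>q<sc t vP. ar t aES q = l \<and> e = {ar t aEU q, ar t aEV q}"
        using t by (intro exI[of _ q]) simp
    qed
    moreover have "covers i ((\<lambda>(u, v). {u, v}) ` set (take (Suc j) es)) t"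
    proof -
      have "covers i {{u, v}} t"
        using t by (auto simp: covers_def intro!: exI[of _ ?p])
      moreover have "covers i ((\<lambda>(u, v). {u, v}) ` set (take j es)) t"
        using inv by (intro covers) (simp add: edges_inv_def)
      ultimately show ?thesis
        using j(1) uv by (auto simp: covers_def take_Suc_conv_app_nth)
    qed
    ultimately show ?thesis using inv t by (simp add: edges_inv_def)
  qed
  note step = this
  have "sc s vI = i" using inv by (simp add: edges_inv_def)
  show ?thesis
    unfolding read_edge_def using j ins \<open>sc s vI = i\<close>
    by (simp add: exec_simps step)
qed

lemma wpt_read_sample:
  assumes i: "i < length S" "sc s vI = i" "sc s vT = length S" and inv: "samples_inv i s"
  shows "wpt read_sample (length (concat ws) * 46 + 20)
    (\<lambda>s'. samples_inv (Suc i) s' \<and> sc s' vI = i \<and> sc s' vT = length S) s"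
proof -
  have len: "length ws = length S" using ws by (simp add: list_all2_lengthD)
  have "encodes_sample (S ! i) (ws ! i)" using ws i(1) by (rule list_all2_nthD)
  then obtain es where es: "lists_edges es (fst (S ! i))"
    "ws ! i = of_bool (snd (S ! i)) # length es # concat (map (\<lambda>(u, v). [u, v]) es)"
    by (auto simp: encodes_sample_def split_beta)
  have es': "(\<lambda>(u, v). {u, v}) ` set es = fst (S ! i)"
    using es(1) by (simp add: lists_edges_def)
  have ins: "ins s = of_bool (snd (S ! i)) # length es #
      (concat (map (\<lambda>(u, v). [u, v]) es) @ concat (drop (Suc i) ws))"
    using inv es(2) Cons_nth_drop_Suc[of i ws, symmetric] i(1) len by (simp add: samples_inv_def)
  \<comment> \<open>Each edge occupies two numbers of the encoding.\<close>
  have "length es \<le> length (ws ! i)"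
    using es(2) by (simp add: length_concat_pairs)
  also have "\<dots> \<le> length (concat ws)"
    using i(1) len by (simp add: length_concat member_le_sum_list)
  finally have m: "length es \<le> length (concat ws)" .
  have loop: "wpt (For vJ vE vM read_edge) T
      (\<lambda>s'. samples_inv (Suc i) s' \<and> sc s' vI = i \<and> sc s' vT = length S) t"
    if t: "edges_inv i es 0 t" "sc t vM = length es" "length (concat ws) * 46 + 5 \<le> T" for t T
  proof (rule wpt_mono[OF wpt_For[where I = "edges_inv i es" and N = "length es" and C = 40]])
    fix s' assume "edges_inv i es (length es) s' \<and> sc s' vM = length es"
    moreover have "length (concat (take (Suc i) ws)) \<ge> length (concat (take i ws)) + length es"
      using i(1) len es(2) by (simp add: take_Suc_conv_app_nth length_concat_pairs)
    ultimately show "samples_inv (Suc i) s' \<and> sc s' vI = i \<and> sc s' vT = length S"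
      using es' by (auto simp: edges_inv_def samples_inv_def less_Suc_eq)
  next
    fix j s assume "j < length es" "edges_inv i es j s" "sc s vJ = j" "sc s vM = length es"
    then show "wpt read_edge 40 (\<lambda>s'. edges_inv i es (Suc j) s' \<and> sc s' vJ = j \<and> sc s' vM = length es) s"
      using es' by (intro wpt_read_edge)
  next
    fix j s a b assume "edges_inv i es j s"
    then show "edges_inv i es j (set_sc vE b (set_sc vJ a s))"
      by (simp add: edges_inv_def header_def edges_ok_def covers_def)
  next
    show "length es * (40 + 6) + 5 \<le> T" using m t(3) by simp
  qed (use t in auto)
  have "edges_inv i es 0 t"
    if "sc t vK = negatives (Suc i)" "sc t vL = of_bool (snd (S ! i))" "ar t = ar s" "outs t = outs s"
      "\<forall>x\<in>{vN, vP, vF, vMu, vIt, vI, vT}. sc t x = sc s x"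
      "ins t = concat (map (\<lambda>(u, v). [u, v]) es) @ concat (drop (Suc i) ws)" for t
    using that inv i
    by (auto simp: edges_inv_def samples_inv_def header_def edges_ok_def covers_def less_Suc_eq)
  note start = this
  have K: "sc s vK = negatives i" using inv by (simp add: samples_inv_def)
  show ?thesis
    unfolding read_sample_def using ins
    by (cases "snd (S ! i)") (simp_all add: exec_simps loop start K negatives_Suc)
qed

lemma wpt_read_samples:
  assumes "header s" "sc s vK = 0" "sc s vP = 0" "ins s = length S # concat ws"
  shows "wpt read_samples (length S * (length (concat ws) * 46 + 26) + 6) (samples_inv (length S)) s"
proof -
  let ?s = "eff (Read vT) s"
  have "samples_inv 0 ?s" "sc ?s vT = length S"
    using assms
    by (simp_all add: samples_inv_def header_def edges_ok_def negatives_def)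
  then have "wpt (For vI vD vT read_sample) (length S * (length (concat ws) * 46 + 26) + 5)
      (samples_inv (length S)) ?s"
    by (intro wpt_mono[OF wpt_For[where I = samples_inv and N = "length S" and
            C = "length (concat ws) * 46 + 20"]] wpt_read_sample)
      (auto simp: samples_inv_def header_def edges_ok_def covers_def)
  then show ?thesis
    unfolding read_samples_def wpt_Op_Seq by (simp add: add.commute)
qed

text \<open>Even a sample without edges contributes its label and its edge count.\<close>

lemma length_samples: "length S \<le> length (concat ws)"
  using ws by (induction rule: list_all2_induct) (auto simp: encodes_sample_def)

text \<open>\<open>L\<close> is the length of the whole word; the summand 2 stands for the counts of
  vertices and samples. Being at least 2, \<open>L\<close> can absorb constant factors into its
  exponent.\<close>

lemma wpt_conscheck_code:
  assumes "L = length vs + length (concat ws) + 2"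
  shows "wpt conscheck_code (16 ^ (num_negative (V, S) * num_negative (V, S)) * L ^ 11)
    (\<lambda>s. conscheck_answer (V, S) (outs s)) (initial_store (length vs # vs @ length S # concat ws))"
proof -
  let ?Q = "\<lambda>s. conscheck_answer (V, S) (outs s)" and ?n = "length vs"
  define F :: nat where "F = 16 ^ (num_negative (V, S) * num_negative (V, S))"
  have solve: "wpt solve_code (L * (L * 55 + 90) + L * 206 + F * (L * 248 + 33) + L * 56 + 40) ?Q s"
    if s: "samples_inv (length S) s" for s
  proof -
    have len: "length ws = length S" using ws by (simp add: list_all2_lengthD)
    have P: "sc s vP \<le> L" using s assms len by (auto simp: samples_inv_def)
    interpret edge_list V S vs "sc s vP" "ar s aEU" "ar s aEV" "ar s aES"
    proof
      show "\<And>p. p < sc s vP \<Longrightarrow> ar s aES p < length S \<and> {ar s aEU p, ar s aEV p} \<in> fst (S ! ar s aES p)"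
        using s by (auto simp: samples_inv_def edges_ok_def)
      show "\<And>i e. i < length S \<Longrightarrow> e \<in> fst (S ! i) \<Longrightarrow>
          \<exists>p<sc s vP. ar s aES p = i \<and> e = {ar s aEU p, ar s aEV p}"
        using s unfolding samples_inv_def covers_def by blast
    qed (fact instance_VS vs)+
    have "negatives (length S) = k"
      by (simp add: negatives_def k_def Neg_def)
    then have "static s"
      using s by (auto simp: static_def samples_inv_def header_def edges_ok_def pos_def)
    moreover have "fresh s" using s by (simp add: fresh_def samples_inv_def header_def)
    moreover have "merge_inv 0 (ar s aC) (ar s aCol) (sc s vF)"
      using merge_inv_0 s by (simp add: samples_inv_def header_def)
    ultimately have "merged 0 s" by (simp add: merged_def)
    moreover have "F = 16 ^ (k * k)" by (simp add: F_def k_eq)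
    moreover have "?n \<le> L" using assms by simp
    ultimately show ?thesis
      using P by (intro wpt_mono[OF wpt_solve_code] add_mono mult_le_mono) auto
  qed
  have read: "wpt (read_samples ;; solve_code)
      (L * (L * 46 + 26) + 6 + (L * (L * 55 + 90) + L * 206 + F * (L * 248 + 33) + L * 56 + 40)) ?Q s"
    if s: "header s" "sc s vK = 0" "sc s vP = 0" "ins s = length S # concat ws" for s
    using assms length_samples
    by (intro wpt_Seq[OF wpt_mono[OF wpt_read_samples[OF s] _ solve] order_refl] add_mono mult_le_mono)
      auto
  let ?T = "L * 26 + 6 + (L * (L * 46 + 26) + 6 + (L * (L * 55 + 90) + L * 206 + F * (L * 248 + 33) + L * 56 + 40))"
  have "wpt conscheck_code ?T ?Q (initial_store (length vs # vs @ length S # concat ws))"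
    unfolding conscheck_code_def
    using assms by (intro wpt_Seq[OF wpt_mono[OF wpt_read_vertices] order_refl] read) auto
  moreover have "?T \<le> F * L ^ 11"
  proof -
    have L: "2 \<le> L" using assms by simp
    have F: "1 \<le> F" by (simp add: F_def)
    have "?T = 101 * (L * L) + 404 * L + 52 + F * (L * 248 + 33)"
      by (simp add: algebra_simps)
    also have "\<dots> \<le> F * (101 * (L * L) + 404 * L + 52) + F * (L * 248 + 33)"
      using F by simp
    also have "\<dots> = F * (101 * (L * L) + 652 * L + 85)"
      by (simp add: algebra_simps)
    \<comment> \<open>From \<open>2 * L \<le> L * L\<close>, the linear term is at most
      \<open>326 * (L * L)\<close> and the constant at most \<open>43 * L\<close>, so the total
      stays below \<open>512 * (L * L)\<close>.\<close>
    also have "101 * (L * L) + 652 * L + 85 \<le> 512 * (L * L)"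
    proof -
      have "2 * L \<le> L * L" using L by simp
      moreover have "85 \<le> 43 * L" using L by simp
      ultimately show ?thesis by linarith
    qed
    \<comment> \<open>\<open>512 = 2 ^ 9\<close>, which explains the exponent
      \<open>11 = 9 + 2\<close>.\<close>
    also have "512 * (L * L) \<le> L ^ 9 * (L * L)"
      using power_mono[OF L, of 9] by simp
    also have "\<dots> = L ^ 11" by (simp add: eval_nat_numeral)
    finally show ?thesis using F by simp
  qed
  ultimately show ?thesis unfolding F_def by (rule wpt_mono)
qed

end

lemma well_formed_conscheck_code: "well_formed conscheck_code"
  by (simp add: conscheck_code_def read_vertices_def read_samples_def read_sample_def read_edge_def
      solve_code_def fail_code_def merge_code_def relabel_def mark_code_def mark_step_def mark_one_def
      search_code_def search_step_def check_code_def check_step_def color_def next_code_def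
      next_step_def print_code_def print_step_def)

text \<open>Every number, even 0, counts for at least one digit.\<close>

lemma length_le_input_size: "length w \<le> input_size w"
  by (induction w) (auto simp: input_size_def)

theorem theorem5:
  "fixed_parameter_tractable conscheck_instance encodes_conscheck conscheck_answer num_negative"
  unfolding fixed_parameter_tractable_def
proof (intro exI[of _ "code conscheck_code 0"] exI[of _ "\<lambda>k. 16 ^ (k * k)"] exI[of _ "11 :: nat"]
    conjI allI impI)
  show "computable (\<lambda>k. 16 ^ (k * k))" by (rule computable_power)
next
  fix I w assume I: "conscheck_instance I" "encodes_conscheck I w"
  obtain V S where VS: "I = (V, S)" by (cases I)
  from I(2) obtain vs ws where w: "lists_set vs V" "list_all2 encodes_sample S ws"
    "w = length vs # vs @ length S # concat ws"
    by (auto simp: encodes_conscheck_def VS)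
  interpret encoded_instance V S vs ws
    using I(1) w by unfold_locales (simp_all add: VS)
  show "\<exists>y. conscheck_answer I y \<and>
     outputs_within (code conscheck_code 0) w (16 ^ (num_negative I * num_negative I) * input_size w ^ 11) y"
  proof -
    let ?k = "num_negative I * num_negative I"
    have "wpt conscheck_code (16 ^ ?k * length w ^ 11) (\<lambda>s. conscheck_answer I (outs s)) (initial_store w)"
      using wpt_conscheck_code[OF refl] w(3) by (simp add: VS)
    then have "wpt conscheck_code (16 ^ ?k * input_size w ^ 11)
        (\<lambda>s. conscheck_answer I (outs s)) (initial_store w)"
      by (rule wpt_mono) (auto intro: mult_le_mono power_mono length_le_input_size)
    \<comment> \<open>An instance may have several correct answers; \<open>y\<close> is the one
      printed by the run, as \<open>outputs_within_code\<close> needs a fixed output.\<close>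
    then obtain y where "conscheck_answer I y"
      "wpt conscheck_code (16 ^ ?k * input_size w ^ 11) (\<lambda>s. outs s = y) (initial_store w)"
      unfolding wpt_def by blast
    then show ?thesis
      using outputs_within_code well_formed_conscheck_code by blast
  qed
qed

end
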